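(* In a plane fronted wave $\overline{M}^{n+2}$ there are no codimension two parabolic weakly future trapped submanifolds $\psi:\Sigma^n\to\overline{M}^{n+2}$ with $\inf_{\Sigma^n}\mu>-\infty$ and $\sup_{\Sigma^n}\nu<+\infty$, where $\mu:=u\circ\psi$ and $\nu:=v\circ\psi$. Likewise, there are no codimension two parabolic weakly past trapped submanifolds $\psi:\Sigma^n\to\overline{M}^{n+2}$ with $\sup_{\Sigma^n}\mu<+\infty$ and $\inf_{\Sigma^n}\nu>-\infty$.
   Context: A plane fronted wave is a Lorentzian manifold $(\overline{M}^{n+2},\langle\ ,\ \rangle)$ with $\overline{M}^{n+2}=\mathbb{R}^2\times M^n$, where $(M^n,g_M)$ is a connected Riemannian manifold, and metric $\langle\ ,\ \rangle=\mathcal{H}(u,x)\,du\otimes du+du\otimes dv+dv\otimes du+g_M$, where $(u,v)$ are the natural coordinates on $\mathbb{R}^2$ and $\mathcal{H}(u,x)$ is a smooth function on $\mathbb{R}^2\times M^n$ independent of $v$. The coordinate vector field $\partial_v=\partial/\partial v$ is lightlike and parallel, and the spacetime is time-oriented so that $\partial_v$ is future pointing. A spacelike submanifold $\psi:\Sigma^k\to\overline{M}^{n+2}$ is an immersion of a connected $k$-dimensional manifold whose induced metric is Riemannian. Its mean curvature vector field is $\overrightarrow{H}=\frac1k\,\mathrm{trace}(\mathrm{II})$, where $\mathrm{II}$ is the second fundamental form, defined by $\overline{\nabla}_XY=\nabla_XY+\mathrm{II}(X,Y)$, with $\overline\nabla$, $\nabla$ the Levi-Civita connections of $\overline{M}^{n+2}$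 and $\Sigma^k$. A spacelike submanifold is weakly future (resp. past) trapped if $\overrightarrow{H}$ is causal (i.e., timelike or lightlike, in particular non-zero) and future (resp. past) pointing everywhere. A complete (non-compact) Riemannian manifold is parabolic if the only superharmonic functions ($\Delta f\le 0$, $\Delta=\mathrm{div}\,\nabla$) bounded from below that it admits are the constants. A spacelike submanifold is parabolic if it is so with its induced metric. *)

theory Defs
  imports "HOL-Analysis.Analysis"
begin

section \<open>Smooth functions on open subsets of Euclidean spaces\<close>

abbreviation dderiv :: "('a::real_normed_vector \<Rightarrow> 'b::real_normed_vector) \<Rightarrow> 'a \<Rightarrow> 'a \<Rightarrow> 'b"
  where "dderiv f x v \<equiv> frechet_derivative f (at x) v"

text \<open>Both notions below are meant for an open set \<open>A\<close>.\<close>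

fun Ck_on :: "nat \<Rightarrow> 'a::euclidean_space set \<Rightarrow> ('a \<Rightarrow> 'b::real_normed_vector) \<Rightarrow> bool"
  where
    "Ck_on 0 A f \<longleftrightarrow> continuous_on A f"
  | "Ck_on (Suc k) A f \<longleftrightarrow>
       (\<forall>x\<in>A. f differentiable (at x)) \<and> (\<forall>v. Ck_on k A (\<lambda>x. dderiv f x v))"

definition smooth_on :: "'a::euclidean_space set \<Rightarrow> ('a \<Rightarrow> 'b::real_normed_vector) \<Rightarrow> bool"
  where "smooth_on A f \<longleftrightarrow> (\<forall>k. Ck_on k A f)"


section \<open>Smooth manifolds\<close>

text \<open>
  A chart is a domain together with a coordinate map into the model space \<open>'e\<close>; the dimension of
  the manifold is \<open>DIM('e)\<close>. Atlases are not required to be maximal.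
\<close>

type_synonym ('m, 'e) chart = "'m set \<times> ('m \<Rightarrow> 'e)"

record ('m, 'e) manifold =
  mtop :: "'m topology"
  atlas :: "('m, 'e) chart set"

abbreviation cdom :: "('m, 'e) chart \<Rightarrow> 'm set" where "cdom c \<equiv> fst c"
abbreviation cmap :: "('m, 'e) chart \<Rightarrow> 'm \<Rightarrow> 'e" where "cmap c \<equiv> snd c"
abbreviation cimg :: "('m, 'e) chart \<Rightarrow> 'e set" where "cimg c \<equiv> cmap c ` cdom c"
abbreviation cinv :: "('m, 'e) chart \<Rightarrow> 'e \<Rightarrow> 'm" where "cinv c \<equiv> inv_into (cdom c) (cmap c)"

definition is_chart :: "'m topology \<Rightarrow> ('m, 'e::euclidean_space) chart \<Rightarrow> bool"
  where "is_chart T c \<longleftrightarrow> openin T (cdom c) \<and> open (cimg c) \<and>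
    homeomorphic_map (subtopology T (cdom c)) (top_of_set (cimg c)) (cmap c)"

definition smooth_manifold :: "('m, 'e::euclidean_space) manifold \<Rightarrow> bool"
  where "smooth_manifold M \<longleftrightarrow>
    topspace (mtop M) \<noteq> {} \<and> Hausdorff_space (mtop M) \<and> second_countable (mtop M) \<and>
    \<Union> (cdom ` atlas M) = topspace (mtop M) \<and>
    (\<forall>c\<in>atlas M. is_chart (mtop M) c) \<and>
    (\<forall>c\<in>atlas M. \<forall>c'\<in>atlas M. smooth_on (cmap c ` (cdom c \<inter> cdom c')) (cmap c' \<circ> cinv c))"

definition chart_at :: "('m, 'e) manifold \<Rightarrow> 'm \<Rightarrow> ('m, 'e) chart"
  where "chart_at M p = (SOME c. c \<in> atlas M \<and> p \<in> cdom c)"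

definition euclidean_manifold :: "('e::euclidean_space, 'e) manifold"
  where "euclidean_manifold = \<lparr>mtop = euclidean, atlas = {(UNIV, \<lambda>x. x)}\<rparr>"

definition prod_manifold ::
    "('m, 'e) manifold \<Rightarrow> ('n, 'f) manifold \<Rightarrow> ('m \<times> 'n, 'e \<times> 'f) manifold"
  where "prod_manifold M N =
    \<lparr>mtop = prod_topology (mtop M) (mtop N),
     atlas = {(cdom c \<times> cdom d, map_prod (cmap c) (cmap d)) | c d. c \<in> atlas M \<and> d \<in> atlas N}\<rparr>"

definition smooth_near :: "('m, 'e::euclidean_space) manifold \<Rightarrow> 'm \<Rightarrow> ('m \<Rightarrow> real) \<Rightarrow> bool"
  where "smooth_near M p f \<longleftrightarrow> (\<exists>c\<in>atlas M. p \<in> cdom c \<and>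
    (\<exists>W. open W \<and> cmap c p \<in> W \<and> W \<subseteq> cimg c \<and> smooth_on W (f \<circ> cinv c)))"

definition smooth_fun :: "('m, 'e::euclidean_space) manifold \<Rightarrow> ('m \<Rightarrow> real) \<Rightarrow> bool"
  where "smooth_fun M f \<longleftrightarrow> (\<forall>p\<in>topspace (mtop M). smooth_near M p f)"

definition smooth_map ::
    "('m, 'e::euclidean_space) manifold \<Rightarrow> ('n, 'f::euclidean_space) manifold \<Rightarrow> ('m \<Rightarrow> 'n) \<Rightarrow> bool"
  where "smooth_map M N \<psi> \<longleftrightarrow> continuous_map (mtop M) (mtop N) \<psi> \<and>
    (\<forall>c\<in>atlas M. \<forall>d\<in>atlas N.
       smooth_on (cmap c ` {p \<in> cdom c. \<psi> p \<in> cdom d}) (cmap d \<circ> \<psi> \<circ> cinv c))"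


section \<open>Tangent vectors\<close>

text \<open>
  A tangent vector at \<open>p\<close> is a derivation on the functions that are smooth near \<open>p\<close>. It is extended
  by \<open>0\<close> to all other functions, so that equality of tangent vectors is equality of functionals and
  the vector space operations are the pointwise ones.
\<close>

type_synonym 'm tvec = "('m \<Rightarrow> real) \<Rightarrow> real"

definition coord_vec ::
    "('m, 'e::euclidean_space) manifold \<Rightarrow> ('m, 'e) chart \<Rightarrow> 'm \<Rightarrow> 'e \<Rightarrow> 'm tvec"
  where "coord_vec M c p a =
    (\<lambda>f. if smooth_near M p f then dderiv (f \<circ> cinv c) (cmap c p) a else 0)"

definition tangent_space :: "('m, 'e::euclidean_space) manifold \<Rightarrow> 'm \<Rightarrow> 'm tvec set"
  where "tangent_space M p = {coord_vec M c p a | c a. c \<in> atlas M \<and> p \<in> cdom c}"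

definition pushforward ::
    "('n, 'f::euclidean_space) manifold \<Rightarrow> ('m \<Rightarrow> 'n) \<Rightarrow> 'm \<Rightarrow> 'm tvec \<Rightarrow> 'n tvec"
  where "pushforward N \<psi> p X = (\<lambda>f. if smooth_near N (\<psi> p) f then X (f \<circ> \<psi>) else 0)"

definition velocity ::
    "('m, 'e::euclidean_space) manifold \<Rightarrow> (real \<Rightarrow> 'm) \<Rightarrow> real \<Rightarrow> 'm tvec"
  where "velocity M \<gamma> t = (\<lambda>f. if smooth_near M (\<gamma> t) f then deriv (f \<circ> \<gamma>) t else 0)"

definition smooth_vector_field ::
    "('m, 'e::euclidean_space) manifold \<Rightarrow> ('m \<Rightarrow> 'm tvec) \<Rightarrow> bool"
  where "smooth_vector_field M X \<longleftrightarrow> (\<forall>c\<in>atlas M. \<exists>Y. smooth_on (cimg c) Y \<and>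
    (\<forall>p\<in>cdom c. X p = coord_vec M c p (Y (cmap c p))))"

definition immersion ::
    "('m, 'e::euclidean_space) manifold \<Rightarrow> ('n, 'f::euclidean_space) manifold \<Rightarrow> ('m \<Rightarrow> 'n) \<Rightarrow> bool"
  where "immersion M N \<psi> \<longleftrightarrow> smooth_map M N \<psi> \<and>
    (\<forall>p\<in>topspace (mtop M). inj_on (pushforward N \<psi> p) (tangent_space M p))"


section \<open>Metrics\<close>

type_synonym 'm metric_tensor = "'m \<Rightarrow> 'm tvec \<Rightarrow> 'm tvec \<Rightarrow> real"

definition in_chart ::
    "('m, 'e::euclidean_space) manifold \<Rightarrow> 'm metric_tensor \<Rightarrow> ('m, 'e) chart \<Rightarrow> 'e \<Rightarrow> 'e \<Rightarrow> 'e \<Rightarrow> real"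
  where "in_chart M g c y a b =
    g (cinv c y) (coord_vec M c (cinv c y) a) (coord_vec M c (cinv c y) b)"

definition riemannian_metric :: "('m, 'e::euclidean_space) manifold \<Rightarrow> 'm metric_tensor \<Rightarrow> bool"
  where "riemannian_metric M g \<longleftrightarrow> (\<forall>c\<in>atlas M.
    (\<forall>y\<in>cimg c. bilinear (in_chart M g c y) \<and>
       (\<forall>a b. in_chart M g c y a b = in_chart M g c y b a) \<and>
       (\<forall>a. a \<noteq> 0 \<longrightarrow> in_chart M g c y a a > 0)) \<and>
    (\<forall>a b. smooth_on (cimg c) (\<lambda>y. in_chart M g c y a b)))"

definition induced_metric ::
    "('n, 'f::euclidean_space) manifold \<Rightarrow> 'n metric_tensor \<Rightarrow> ('m \<Rightarrow> 'n) \<Rightarrow> 'm metric_tensor"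
  where "induced_metric N g \<psi> =
    (\<lambda>p X Y. g (\<psi> p) (pushforward N \<psi> p X) (pushforward N \<psi> p Y))"


section \<open>Levi-Civita connection and Laplacian\<close>

text \<open>
  In this section \<open>G y\<close> is the coordinate expression of a (pseudo-Riemannian) metric on an open
  subset of the model space, and vector fields are given by their coordinate expressions.
\<close>

text \<open>The vector which is metrically equivalent to the covector \<open>\<alpha>\<close>.\<close>

definition sharp :: "('e \<Rightarrow> 'e \<Rightarrow> real) \<Rightarrow> ('e \<Rightarrow> real) \<Rightarrow> 'e"
  where "sharp B \<alpha> = (THE z. \<forall>w. B z w = \<alpha> w)"

text \<open>
  Koszul's formula for the constant vector fields \<open>a\<close>, \<open>b\<close>; in coordinates these are the
  Christoffel symbols, i.e. \<open>christoffel G y a b\<close> has the components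
  \<open>\<Gamma>\<^sup>k\<^sub>i\<^sub>j a\<^sup>i b\<^sup>j\<close>. Lemmas \<open>christoffel_torsion_free\<close>, \<open>christoffel_metric\<close> and
  \<open>christoffel_unique\<close> below show that this is the Levi-Civita connection.
\<close>

definition christoffel :: "('e::real_normed_vector \<Rightarrow> 'e \<Rightarrow> 'e \<Rightarrow> real) \<Rightarrow> 'e \<Rightarrow> 'e \<Rightarrow> 'e \<Rightarrow> 'e"
  where "christoffel G y a b = sharp (G y) (\<lambda>w.
    (dderiv (\<lambda>z. G z b w) y a + dderiv (\<lambda>z. G z a w) y b - dderiv (\<lambda>z. G z a b) y w) / 2)"

text \<open>
  The covariant derivative, in the direction \<open>a\<close> at \<open>x\<close>, of a vector field \<open>Y\<close> along a map \<open>F\<close>.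
\<close>

definition cov_deriv_along ::
    "('f::real_normed_vector \<Rightarrow> 'f \<Rightarrow> 'f \<Rightarrow> real) \<Rightarrow> ('e::real_normed_vector \<Rightarrow> 'f) \<Rightarrow> ('e \<Rightarrow> 'f) \<Rightarrow> 'e \<Rightarrow> 'e \<Rightarrow> 'f"
  where "cov_deriv_along G F Y x a = dderiv Y x a + christoffel G (F x) (dderiv F x a) (Y x)"

definition cov_deriv ::
    "('e::real_normed_vector \<Rightarrow> 'e \<Rightarrow> 'e \<Rightarrow> real) \<Rightarrow> ('e \<Rightarrow> 'e) \<Rightarrow> 'e \<Rightarrow> 'e \<Rightarrow> 'e"
  where "cov_deriv G Y x a = dderiv Y x a + christoffel G x a (Y x)"

definition gradient ::
    "('e::real_normed_vector \<Rightarrow> 'e \<Rightarrow> 'e \<Rightarrow> real) \<Rightarrow> ('e \<Rightarrow> real) \<Rightarrow> 'e \<Rightarrow> 'e"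
  where "gradient G f x = sharp (G x) (\<lambda>w. dderiv f x w)"

definition divergence ::
    "('e::euclidean_space \<Rightarrow> 'e \<Rightarrow> 'e \<Rightarrow> real) \<Rightarrow> ('e \<Rightarrow> 'e) \<Rightarrow> 'e \<Rightarrow> real"
  where "divergence G Y x = (\<Sum>b\<in>Basis. cov_deriv G Y x b \<bullet> b)"

text \<open>The value does not depend on the chart around \<open>p\<close> that is used.\<close>

definition laplacian ::
    "('m, 'e::euclidean_space) manifold \<Rightarrow> 'm metric_tensor \<Rightarrow> ('m \<Rightarrow> real) \<Rightarrow> 'm \<Rightarrow> real"
  where "laplacian M g f p =
    (let c = chart_at M p; G = in_chart M g c
     in divergence G (gradient G (f \<circ> cinv c)) (cmap c p))"

lemma sharp_works:
  fixes B :: "'e::euclidean_space \<Rightarrow> 'e \<Rightarrow> real"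
  assumes B: "bilinear B" and nondeg: "\<And>z. (\<And>w. B z w = 0) \<Longrightarrow> z = 0" and "linear \<alpha>"
  shows "B (sharp B \<alpha>) w = \<alpha> w"
proof -
  define L where "L z = (\<Sum>b\<in>Basis. B z b *\<^sub>R b)" for z
  have repr: "\<beta> w = (\<Sum>b\<in>Basis. \<beta> b *\<^sub>R b) \<bullet> w"
    if "linear \<beta>" for \<beta> :: "'e \<Rightarrow> real" and w
  proof -
    have "\<beta> w = \<beta> (\<Sum>b\<in>Basis. (w \<bullet> b) *\<^sub>R b)"
      by (simp only: euclidean_representation)
    also have "\<dots> = (\<Sum>b\<in>Basis. (w \<bullet> b) * \<beta> b)"
      by (simp only: linear_sum[OF that] linear_cmul[OF that] o_def real_scaleR_def)
    also have "\<dots> = (\<Sum>b\<in>Basis. \<beta> b *\<^sub>R b) \<bullet> w"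
      unfolding inner_sum_left
    proof (rule sum.cong[OF refl])
      show "(w \<bullet> b) * \<beta> b = \<beta> b *\<^sub>R b \<bullet> w" for b
        by (simp only: inner_scaleR_left inner_commute[of w b] mult.commute)
    qed
    finally show ?thesis .
  qed
  have B_eq: "B z w = L z \<bullet> w" for z w
    unfolding L_def using B by (intro repr) (simp add: bilinear_def)
  have "linear L"
    unfolding L_def
    by (rule linearI) (simp_all only: bilinear_ladd[OF B] bilinear_lmul[OF B] scaleR_add_left
        sum.distrib scaleR_sum_right scaleR_scaleR real_scaleR_def)
  moreover have "inj L"
    unfolding linear_injective_0[OF \<open>linear L\<close>]
  proof (intro allI impI)
    show "z = 0" if "L z = 0" for z
      by (rule nondeg) (simp only: B_eq that inner_zero_left)
  qed
  ultimately have "surj L" using linear_injective_imp_surjective by blast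
  then obtain z where z: "L z = (\<Sum>b\<in>Basis. \<alpha> b *\<^sub>R b)" by (metis surjD)
  have Bz: "B z w = \<alpha> w" for w
    unfolding B_eq z by (rule repr[OF \<open>linear \<alpha>\<close>, symmetric])
  have unique: "z' = z" if "\<forall>w. B z' w = \<alpha> w" for z'
  proof -
    have "z' - z = 0"
      by (rule nondeg) (simp only: bilinear_lsub[OF B] Bz that[rule_format] diff_self)
    then show ?thesis by simp
  qed
  have "\<forall>w. B (sharp B \<alpha>) w = \<alpha> w"
    unfolding sharp_def by (rule theI[of _ z]) (use Bz unique in blast)+
  then show ?thesis by (rule spec)
qed

context
  fixes G :: "'e::euclidean_space \<Rightarrow> 'e \<Rightarrow> 'e \<Rightarrow> real" and U :: "'e set" and y :: 'e
  assumes U: "open U" "y \<in> U"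
    and bil: "\<And>z. z \<in> U \<Longrightarrow> bilinear (G z)"
    and symm: "\<And>z a b. z \<in> U \<Longrightarrow> G z a b = G z b a"
    and nondeg: "\<And>a. (\<And>b. G y a b = 0) \<Longrightarrow> a = 0"
    and diff: "\<And>a b. (\<lambda>z. G z a b) differentiable (at y)"
begin

private lemma dG_sym: "dderiv (\<lambda>z. G z a b) y v = dderiv (\<lambda>z. G z b a) y v"
proof -
  have "((\<lambda>z. G z b a) has_derivative dderiv (\<lambda>z. G z b a) y) (at y)"
    by (rule iffD1[OF frechet_derivative_works diff])
  then have "((\<lambda>z. G z a b) has_derivative dderiv (\<lambda>z. G z b a) y) (at y)"
    by (rule has_derivative_transform_within_open[OF _ U]) (rule symm)
  then show ?thesis by (rule frechet_derivative_at[symmetric, THEN fun_cong])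
qed

private lemma linear_dG: "linear (\<lambda>v. dderiv (\<lambda>z. G z a b) y v)"
  by (rule linear_frechet_derivative[OF diff])

private lemma linear_dG_right: "linear (\<lambda>b. dderiv (\<lambda>z. G z a b) y v)"
proof (rule linearI)
  fix b c
  have "((\<lambda>z. G z a b + G z a c) has_derivative
      (\<lambda>v. dderiv (\<lambda>z. G z a b) y v + dderiv (\<lambda>z. G z a c) y v)) (at y)"
    by (intro has_derivative_add iffD1[OF frechet_derivative_works diff])
  then have "((\<lambda>z. G z a (b + c)) has_derivative
      (\<lambda>v. dderiv (\<lambda>z. G z a b) y v + dderiv (\<lambda>z. G z a c) y v)) (at y)"
    by (rule has_derivative_transform_within_open[OF _ U]) (simp add: bil bilinear_radd)
  then show "dderiv (\<lambda>z. G z a (b + c)) y v =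
      dderiv (\<lambda>z. G z a b) y v + dderiv (\<lambda>z. G z a c) y v"
    by (rule frechet_derivative_at[symmetric, THEN fun_cong])
next
  fix r b
  have "((\<lambda>z. r *\<^sub>R G z a b) has_derivative (\<lambda>v. r *\<^sub>R dderiv (\<lambda>z. G z a b) y v)) (at y)"
    by (intro has_derivative_scaleR_right iffD1[OF frechet_derivative_works diff])
  then have "((\<lambda>z. G z a (r *\<^sub>R b)) has_derivative (\<lambda>v. r *\<^sub>R dderiv (\<lambda>z. G z a b) y v)) (at y)"
    by (rule has_derivative_transform_within_open[OF _ U]) (simp add: bil bilinear_rmul)
  then show "dderiv (\<lambda>z. G z a (r *\<^sub>R b)) y v = r *\<^sub>R dderiv (\<lambda>z. G z a b) y v"
    by (rule frechet_derivative_at[symmetric, THEN fun_cong])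
qed

lemma christoffel_koszul:
  "G y (christoffel G y a b) w =
    (dderiv (\<lambda>z. G z b w) y a + dderiv (\<lambda>z. G z a w) y b - dderiv (\<lambda>z. G z a b) y w) / 2"
proof -
  have lin: "linear (\<lambda>w. (dderiv (\<lambda>z. G z b w) y a + dderiv (\<lambda>z. G z a w) y b
      - dderiv (\<lambda>z. G z a b) y w) / 2)"
    by (rule linearI)
      (simp_all only: linear_add[OF linear_dG] linear_cmul[OF linear_dG]
        linear_add[OF linear_dG_right] linear_cmul[OF linear_dG_right] real_scaleR_def,
        simp_all add: field_simps)
  show ?thesis
    unfolding christoffel_def by (rule sharp_works[OF bil[OF U(2)] _ lin]) (rule nondeg)
qed

lemma christoffel_torsion_free: "christoffel G y a b = christoffel G y b a"
  unfolding christoffel_def dG_sym[of b a] by (simp only: add.commute)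

lemma christoffel_metric:
  "dderiv (\<lambda>z. G z b c) y a = G y (christoffel G y a b) c + G y b (christoffel G y a c)"
  using christoffel_koszul[of a b c] christoffel_koszul[of a c b] dG_sym[of c b a]
    symm[OF U(2), of b "christoffel G y a c"]
  by (simp only: field_simps)

lemma christoffel_unique:
  assumes tf: "\<And>a b. \<Gamma> a b = \<Gamma> b a"
    and met: "\<And>a b c. dderiv (\<lambda>z. G z b c) y a = G y (\<Gamma> a b) c + G y b (\<Gamma> a c)"
  shows "\<Gamma> a b = christoffel G y a b"
proof -
  have "G y (\<Gamma> a b) w = G y (christoffel G y a b) w" for w
  proof -
    have "2 * G y (\<Gamma> a b) w = dderiv (\<lambda>z. G z b w) y a + dderiv (\<lambda>z. G z a w) y b
        - dderiv (\<lambda>z. G z a b) y w"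
      using met[of b w a] met[of a w b] met[of a b w] symm[OF U(2), of a "\<Gamma> w b"]
        symm[OF U(2), of b "\<Gamma> a w"]
      unfolding tf[of b a] tf[of w a] tf[of w b] by linarith
    then show ?thesis
      unfolding christoffel_koszul by simp
  qed
  then show ?thesis
    using nondeg[of "\<Gamma> a b - christoffel G y a b"] bil[OF U(2)] by (simp add: bilinear_lsub)
qed

end


section \<open>Second fundamental form and mean curvature\<close>

text \<open>
  \<open>F\<close> is the coordinate expression of an immersion, \<open>G'\<close> that of the ambient metric and \<open>G\<close> that of
  the induced metric. Since \<open>II\<close> is a tensor it is enough to apply the Gauss formula
  \<open>II(X,Y) = \<nabla>'\<^sub>X Y - \<nabla>\<^sub>X Y\<close> to the constant vector fields \<open>a\<close>, \<open>b\<close>.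
\<close>

definition second_fundamental_form ::
    "('f::real_normed_vector \<Rightarrow> 'f \<Rightarrow> 'f \<Rightarrow> real) \<Rightarrow> ('e::real_normed_vector \<Rightarrow> 'e \<Rightarrow> 'e \<Rightarrow> real) \<Rightarrow>
      ('e \<Rightarrow> 'f) \<Rightarrow> 'e \<Rightarrow> 'e \<Rightarrow> 'e \<Rightarrow> 'f"
  where "second_fundamental_form G' G F x a b =
    cov_deriv_along G' F (\<lambda>z. dderiv F z b) x a - dderiv F x (cov_deriv G (\<lambda>z. b) x a)"

text \<open>
  The trace of the bilinear map \<open>T\<close> with respect to the inner product \<open>B\<close>. As \<open>sharp B\<close> raises
  indices, this is \<open>\<Sum>\<^sub>i\<^sub>,\<^sub>j B\<^sup>i\<^sup>j T\<^sub>i\<^sub>j\<close>.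
\<close>

definition metric_trace ::
    "('e::euclidean_space \<Rightarrow> 'e \<Rightarrow> real) \<Rightarrow> ('e \<Rightarrow> 'e \<Rightarrow> 'f::real_vector) \<Rightarrow> 'f"
  where "metric_trace B T = (\<Sum>b\<in>Basis. T b (sharp B (\<lambda>w. w \<bullet> b)))"

text \<open>The vector does not depend on the charts around \<open>p\<close> and \<open>\<psi> p\<close> that are used.\<close>

definition mean_curvature_vector ::
    "('s, 'e::euclidean_space) manifold \<Rightarrow> ('m, 'f::euclidean_space) manifold \<Rightarrow> 'm metric_tensor \<Rightarrow>
      ('s \<Rightarrow> 'm) \<Rightarrow> 's \<Rightarrow> 'm tvec"
  where "mean_curvature_vector S N g \<psi> p =
    (let c = chart_at S p; d = chart_at N (\<psi> p); x = cmap c p;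
         G = in_chart S (induced_metric N g \<psi>) c; G' = in_chart N g d;
         F = cmap d \<circ> \<psi> \<circ> cinv c
     in coord_vec N d (\<psi> p)
          ((1 / real DIM('e)) *\<^sub>R metric_trace (G x) (second_fundamental_form G' G F x)))"

definition spacelike_submanifold ::
    "('s, 'e::euclidean_space) manifold \<Rightarrow> ('m, 'f::euclidean_space) manifold \<Rightarrow> 'm metric_tensor \<Rightarrow>
      ('s \<Rightarrow> 'm) \<Rightarrow> bool"
  where "spacelike_submanifold S N g \<psi> \<longleftrightarrow> smooth_manifold S \<and> connected_space (mtop S) \<and>
    immersion S N \<psi> \<and> riemannian_metric S (induced_metric N g \<psi>)"


section \<open>Causality and trapped submanifolds\<close>

definition timelike :: "'m metric_tensor \<Rightarrow> 'm \<Rightarrow> 'm tvec \<Rightarrow> bool"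
  where "timelike g p X \<longleftrightarrow> g p X X < 0"

definition lightlike :: "'m metric_tensor \<Rightarrow> 'm \<Rightarrow> 'm tvec \<Rightarrow> bool"
  where "lightlike g p X \<longleftrightarrow> X \<noteq> (\<lambda>f. 0) \<and> g p X X = 0"

definition causal :: "'m metric_tensor \<Rightarrow> 'm \<Rightarrow> 'm tvec \<Rightarrow> bool"
  where "causal g p X \<longleftrightarrow> timelike g p X \<or> lightlike g p X"

definition time_orientation ::
    "('m, 'e::euclidean_space) manifold \<Rightarrow> 'm metric_tensor \<Rightarrow> ('m \<Rightarrow> 'm tvec) \<Rightarrow> bool"
  where "time_orientation N g \<tau> \<longleftrightarrow> smooth_vector_field N \<tau> \<and>
    (\<forall>p\<in>topspace (mtop N). timelike g p (\<tau> p))"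

definition future_pointing ::
    "'m metric_tensor \<Rightarrow> ('m \<Rightarrow> 'm tvec) \<Rightarrow> 'm \<Rightarrow> 'm tvec \<Rightarrow> bool"
  where "future_pointing g \<tau> p X \<longleftrightarrow> causal g p X \<and> g p (\<tau> p) X < 0"

definition past_pointing ::
    "'m metric_tensor \<Rightarrow> ('m \<Rightarrow> 'm tvec) \<Rightarrow> 'm \<Rightarrow> 'm tvec \<Rightarrow> bool"
  where "past_pointing g \<tau> p X \<longleftrightarrow> causal g p X \<and> g p (\<tau> p) X > 0"

definition weakly_future_trapped ::
    "('s, 'e::euclidean_space) manifold \<Rightarrow> ('m, 'f::euclidean_space) manifold \<Rightarrow> 'm metric_tensor \<Rightarrow>
      ('m \<Rightarrow> 'm tvec) \<Rightarrow> ('s \<Rightarrow> 'm) \<Rightarrow> bool"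
  where "weakly_future_trapped S N g \<tau> \<psi> \<longleftrightarrow> spacelike_submanifold S N g \<psi> \<and>
    (\<forall>p\<in>topspace (mtop S). future_pointing g \<tau> (\<psi> p) (mean_curvature_vector S N g \<psi> p))"

definition weakly_past_trapped ::
    "('s, 'e::euclidean_space) manifold \<Rightarrow> ('m, 'f::euclidean_space) manifold \<Rightarrow> 'm metric_tensor \<Rightarrow>
      ('m \<Rightarrow> 'm tvec) \<Rightarrow> ('s \<Rightarrow> 'm) \<Rightarrow> bool"
  where "weakly_past_trapped S N g \<tau> \<psi> \<longleftrightarrow> spacelike_submanifold S N g \<psi> \<and>
    (\<forall>p\<in>topspace (mtop S). past_pointing g \<tau> (\<psi> p) (mean_curvature_vector S N g \<psi> p))"


section \<open>Completeness and parabolicity\<close>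

text \<open>
  The Riemannian distance. The curves need not be regular, so that smooth curves give the same
  infimum as piecewise smooth ones.
\<close>

definition riemannian_dist ::
    "('m, 'e::euclidean_space) manifold \<Rightarrow> 'm metric_tensor \<Rightarrow> 'm \<Rightarrow> 'm \<Rightarrow> real"
  where "riemannian_dist M g p q =
    (if p \<in> topspace (mtop M) \<and> q \<in> topspace (mtop M)
     then Inf {integral {0..1} (\<lambda>t. sqrt (g (\<gamma> t) (velocity M \<gamma> t) (velocity M \<gamma> t))) | \<gamma>.
            smooth_map euclidean_manifold M \<gamma> \<and> \<gamma> 0 = p \<and> \<gamma> 1 = q}
     else 0)"

definition complete_riemannian :: "('m, 'e::euclidean_space) manifold \<Rightarrow> 'm metric_tensor \<Rightarrow> bool"
  where "complete_riemannian M g \<longleftrightarrow>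
    Metric_space.mcomplete (topspace (mtop M)) (riemannian_dist M g)"

definition superharmonic ::
    "('m, 'e::euclidean_space) manifold \<Rightarrow> 'm metric_tensor \<Rightarrow> ('m \<Rightarrow> real) \<Rightarrow> bool"
  where "superharmonic M g f \<longleftrightarrow> smooth_fun M f \<and> (\<forall>p\<in>topspace (mtop M). laplacian M g f p \<le> 0)"

definition parabolic :: "('m, 'e::euclidean_space) manifold \<Rightarrow> 'm metric_tensor \<Rightarrow> bool"
  where "parabolic M g \<longleftrightarrow> complete_riemannian M g \<and> \<not> compact_space (mtop M) \<and>
    (\<forall>f. superharmonic M g f \<and> bdd_below (f ` topspace (mtop M)) \<longrightarrow>
       f constant_on topspace (mtop M))"


section \<open>Plane fronted waves\<close>

definition pfw_manifold ::
    "('m, 'e::euclidean_space) manifold \<Rightarrow> ((real \<times> real) \<times> 'm, (real \<times> real) \<times> 'e) manifold"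
  where "pfw_manifold M = prod_manifold euclidean_manifold M"

definition coord_u :: "(real \<times> real) \<times> 'm \<Rightarrow> real" where "coord_u = (\<lambda>((u, v), x). u)"
definition coord_v :: "(real \<times> real) \<times> 'm \<Rightarrow> real" where "coord_v = (\<lambda>((u, v), x). v)"

text \<open>\<open>X coord_u = du X\<close> and \<open>X coord_v = dv X\<close>, as tangent vectors are derivations.\<close>

definition pfw_metric ::
    "('m, 'e::euclidean_space) manifold \<Rightarrow> 'm metric_tensor \<Rightarrow> (real \<Rightarrow> 'm \<Rightarrow> real) \<Rightarrow>
      ((real \<times> real) \<times> 'm) metric_tensor"
  where "pfw_metric M g \<H> = (\<lambda>((u, v), x) X Y.
    \<H> u x * (X coord_u * Y coord_u) + X coord_u * Y coord_v + X coord_v * Y coord_u +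
    g x (pushforward M snd ((u, v), x) X) (pushforward M snd ((u, v), x) Y))"

definition partial_v ::
    "('m, 'e::euclidean_space) manifold \<Rightarrow> (real \<times> real) \<times> 'm \<Rightarrow> ((real \<times> real) \<times> 'm) tvec"
  where "partial_v M = (\<lambda>((u, v), x). velocity (pfw_manifold M) (\<lambda>s. ((u, s), x)) v)"

text \<open>
  The data of a plane fronted wave with its time orientation. That \<open>pfw_metric\<close> has Lorentzian
  signature is automatic.
\<close>

definition plane_fronted_wave ::
    "('m, 'e::euclidean_space) manifold \<Rightarrow> 'm metric_tensor \<Rightarrow> (real \<Rightarrow> 'm \<Rightarrow> real) \<Rightarrow>
      ((real \<times> real) \<times> 'm \<Rightarrow> ((real \<times> real) \<times> 'm) tvec) \<Rightarrow> bool"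
  where "plane_fronted_wave M g \<H> \<tau> \<longleftrightarrow>
    smooth_manifold M \<and> connected_space (mtop M) \<and> riemannian_metric M g \<and>
    smooth_fun (pfw_manifold M) (\<lambda>((u, v), x). \<H> u x) \<and>
    time_orientation (pfw_manifold M) (pfw_metric M g \<H>) \<tau> \<and>
    (\<forall>q\<in>topspace (mtop (pfw_manifold M)).
       future_pointing (pfw_metric M g \<H>) \<tau> q (partial_v M q))"

end

theory Submission
  imports Defs
begin

text \<open>
  Both coordinates \<open>u\<close> and \<open>v\<close> are used as test functions for parabolicity, one after the other. For a
  linear function \<open>L\<close> of \<open>(u, v)\<close> the Gauss formula gives, along the submanifold,
  \<open>\<Delta> (L \<circ> \<psi>) = trace of the ambient Hessian of L on tangent vectors + n * L(H)\<close>, where \<open>H\<close> is the mean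
  curvature vector and \<open>L(H)\<close> is \<open>L\<close> of its \<open>(u, v)\<close>-components. The ambient Hessian of \<open>L\<close> is minus the
  \<open>L\<close>-component of the Christoffel symbols, so that it is enough to know these
  (\<open>mean_curvature_laplacian\<close>).

  Since \<open>\<partial>\<^sub>v\<close> is parallel and metrically equivalent to \<open>du\<close>, the ambient Hessian of \<open>u\<close> vanishes
  (\<open>christoffel_wave_u\<close>) and \<open>\<Delta> \<mu> = n * du(H) = n * \<langle>H, \<partial>\<^sub>v\<rangle>\<close>. If \<open>H\<close> is causal and future pointing, then
  this is \<open>\<le> 0\<close>, because two future causal vectors have a nonpositive product
  (\<open>wave_form_timecone\<close>). So \<open>\<mu>\<close> is superharmonic and bounded below, hence constant by parabolicity.
  Now the tangent vectors of the submanifold are annihilated by \<open>du\<close>, and on such vectors the ambient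
  Hessian of \<open>v\<close> vanishes as well (\<open>christoffel_wave_v\<close>); thus \<open>\<Delta> \<nu> = n * dv(H)\<close>. Moreover
  \<open>du(H) = 0\<close>, and a causal vector with this property is a multiple of \<open>\<partial>\<^sub>v\<close>
  (\<open>wave_form_causal_null\<close>), a positive one as \<open>H\<close> is future pointing. So \<open>\<Delta> \<nu> > 0\<close>, and \<open>- \<nu>\<close> is
  superharmonic and bounded below. It is then constant, which contradicts \<open>\<Delta> \<nu> > 0\<close>.

  The past case is the same argument with all signs reversed. Both are treated at once with a sign
  \<open>\<epsilon>\<close> in front of \<open>H\<close>, \<open>u\<close> and \<open>v\<close>.

  The analytic part is the identity between the divergence of the gradient and the metric trace of
  the Hessian (\<open>divergence_gradient\<close>). It presupposes that the gradient is differentiable, which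
  follows from Cramer's rule (\<open>sharp_differentiable\<close>). The rest is bookkeeping: vectors and
  functions on the product manifold are compared with their expressions in product charts.
\<close>


section \<open>Smoothness and linear maps\<close>

lemma dderiv_eqI: "(f has_derivative D) (at x) \<Longrightarrow> dderiv f x v = D v"
  using frechet_derivative_at[of f D x] by simp

lemma dderiv_linear_comp:
  assumes "bounded_linear L" "f differentiable (at x)"
  shows "dderiv (\<lambda>z. L (f z)) x v = L (dderiv f x v)"
  by (rule dderiv_eqI)
    (rule bounded_linear.has_derivative[OF assms(1) iffD1[OF frechet_derivative_works assms(2)]])

lemma dderiv_comp_linear:
  assumes "bounded_linear L" "f differentiable (at (L x))"
  shows "dderiv (\<lambda>z. f (L z)) x v = dderiv f (L x) (L v)"
  using diff_chain_at[OF bounded_linear_imp_has_derivative[OF assms(1)]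
      iffD1[OF frechet_derivative_works assms(2)]]
  by (simp add: comp_def dderiv_eqI)

lemma differentiable_linear_comp:
  assumes "bounded_linear L" "f differentiable (at x)"
  shows "(\<lambda>z. L (f z)) differentiable (at x)"
  using bounded_linear.has_derivative[OF assms(1) iffD1[OF frechet_derivative_works assms(2)]]
  by (rule differentiableI)

lemma differentiable_comp_linear:
  assumes "bounded_linear L" "f differentiable (at (L x))"
  shows "(\<lambda>z. f (L z)) differentiable (at x)"
  using diff_chain_at[OF bounded_linear_imp_has_derivative[OF assms(1)]
      iffD1[OF frechet_derivative_works assms(2)]]
  unfolding comp_def by (rule differentiableI)

lemma differentiable_cong_open:
  assumes "f differentiable (at x)" "open A" "x \<in> A" "\<And>z. z \<in> A \<Longrightarrow> f z = g z"
  shows "g differentiable (at x)"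
  using assms by (meson differentiable_def has_derivative_transform_within_open)

lemma dderiv_cong_open:
  assumes "f differentiable (at x)" "open A" "x \<in> A" "\<And>z. z \<in> A \<Longrightarrow> f z = g z"
  shows "dderiv g x v = dderiv f x v"
  using frechet_derivative_transform_within_open[OF assms] by simp

lemma Ck_on_cong:
  assumes "Ck_on k A f" "open A" "\<And>z. z \<in> A \<Longrightarrow> f z = g z"
  shows "Ck_on k A g"
  using assms
proof (induction k arbitrary: f g)
  case 0
  then show ?case by (simp cong: continuous_on_cong)
next
  case (Suc k)
  show ?case
  proof (simp, intro conjI ballI allI)
    show "g differentiable (at x)" if "x \<in> A" for x
      using Suc.prems that by (auto intro: differentiable_cong_open)
    show "Ck_on k A (\<lambda>x. dderiv g x v)" for v
    proof (rule Suc.IH[OF _ Suc.prems(2)])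
      show "Ck_on k A (\<lambda>x. dderiv f x v)" using Suc.prems(1) by simp
      show "dderiv f z v = dderiv g z v" if "z \<in> A" for z
        using Suc.prems that by (intro dderiv_cong_open[symmetric]) auto
    qed
  qed
qed

lemma Ck_on_subset: "Ck_on k A f \<Longrightarrow> B \<subseteq> A \<Longrightarrow> Ck_on k B f"
  by (induction k arbitrary: f) (auto intro: continuous_on_subset)

lemma Ck_on_linear_comp:
  assumes "bounded_linear L" "open A" "Ck_on k A f"
  shows "Ck_on k A (\<lambda>z. L (f z))"
  using assms(3)
proof (induction k arbitrary: f)
  case 0
  then show ?case using bounded_linear.continuous_on[OF assms(1)] by simp
next
  case (Suc k)
  show ?case
  proof (simp, intro conjI ballI allI)
    show "(\<lambda>z. L (f z)) differentiable (at x)" if "x \<in> A" for x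
      using Suc.prems that by (auto intro: differentiable_linear_comp[OF assms(1)])
    show "Ck_on k A (\<lambda>x. dderiv (\<lambda>z. L (f z)) x v)" for v
    proof (rule Ck_on_cong[OF _ assms(2)])
      show "Ck_on k A (\<lambda>x. L (dderiv f x v))" using Suc by simp
      show "L (dderiv f z v) = dderiv (\<lambda>z. L (f z)) z v" if "z \<in> A" for z
        using Suc.prems that by (simp add: dderiv_linear_comp[OF assms(1)])
    qed
  qed
qed

lemma Ck_on_comp_linear:
  assumes "bounded_linear L" "open A" "Ck_on k A f"
  shows "Ck_on k (L -` A) (\<lambda>z. f (L z))"
  using assms(3)
proof (induction k arbitrary: f)
  case 0
  have "continuous_on (L -` A) L"
    by (simp add: assms(1) linear_continuous_on)
  with 0 show ?case by (auto intro: continuous_on_compose2)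
next
  case (Suc k)
  have opn: "open (L -` A)"
    by (rule open_vimage[OF assms(2) linear_continuous_on[OF assms(1)]])
  show ?case
  proof (unfold Ck_on.simps, intro conjI ballI allI)
    show "(\<lambda>z. f (L z)) differentiable (at x)" if "x \<in> L -` A" for x
      using Suc.prems that by (auto intro: differentiable_comp_linear[OF assms(1)])
    show "Ck_on k (L -` A) (\<lambda>x. dderiv (\<lambda>z. f (L z)) x v)" for v
    proof (rule Ck_on_cong[OF _ opn])
      show "Ck_on k (L -` A) (\<lambda>x. dderiv f (L x) (L v))"
        using Suc.prems by (intro Suc.IH[where f = "\<lambda>y. dderiv f y (L v)"]) simp
      show "dderiv f (L z) (L v) = dderiv (\<lambda>z. f (L z)) z v" if "z \<in> L -` A" for z
        using Suc.prems that by (simp add: dderiv_comp_linear[OF assms(1)])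
    qed
  qed
qed

lemma Ck_on_const: "Ck_on k A (\<lambda>z. c)"
  by (induction k arbitrary: c) auto

lemma Ck_on_bounded_linear:
  assumes "bounded_linear L"
  shows "Ck_on k A L"
proof (cases k)
  case 0
  then show ?thesis by (simp add: assms linear_continuous_on)
next
  case (Suc j)
  have "dderiv L x v = L v" for x v
    by (rule dderiv_eqI[OF bounded_linear_imp_has_derivative[OF assms]])
  then show ?thesis
    using assms by (simp add: Suc Ck_on_const bounded_linear_imp_differentiable)
qed

lemma smooth_on_differentiable:
  assumes "smooth_on A f" "x \<in> A"
  shows "f differentiable (at x)"
  using assms(1)[unfolded smooth_on_def, rule_format, of "Suc 0"] assms(2) by simp

lemma smooth_on_dderiv_differentiable:
  assumes "smooth_on A f" "x \<in> A"
  shows "(\<lambda>z. dderiv f z v) differentiable (at x)"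
  using assms(1)[unfolded smooth_on_def, rule_format, of "Suc (Suc 0)"] assms(2) by simp

section \<open>The Laplacian as the trace of the Hessian\<close>

text \<open>
  Positive definite coefficients on an open set, with the one derivative that enters the Christoffel
  symbols. The notion is local, so a metric in a chart can be restricted to the smaller domains
  on which an immersion is expressed in coordinates.
\<close>

definition metric_on :: "'e::euclidean_space set \<Rightarrow> ('e \<Rightarrow> 'e \<Rightarrow> 'e \<Rightarrow> real) \<Rightarrow> bool"
  where "metric_on U G \<longleftrightarrow> open U \<and>
    (\<forall>z\<in>U. bilinear (G z) \<and> (\<forall>a b. G z a b = G z b a) \<and> (\<forall>a. a \<noteq> 0 \<longrightarrow> G z a a > 0) \<and>
      (\<forall>a b. (\<lambda>y. G y a b) differentiable (at z)))"

lemma metric_onD: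
  assumes "metric_on U G" "z \<in> U"
  shows "bilinear (G z)" "G z a b = G z b a" "a \<noteq> 0 \<Longrightarrow> G z a a > 0"
    "(\<lambda>y. G y a b) differentiable (at z)"
  using assms by (auto simp: metric_on_def)

lemma metric_on_open: "metric_on U G \<Longrightarrow> open U"
  by (simp add: metric_on_def)

lemma metric_on_subset: "metric_on U G \<Longrightarrow> open V \<Longrightarrow> V \<subseteq> U \<Longrightarrow> metric_on V G"
  by (auto simp: metric_on_def)

lemma metric_on_nondeg:
  assumes "metric_on U G" "z \<in> U" "\<And>b. G z a b = 0"
  shows "a = 0"
  using metric_onD(3)[OF assms(1,2), of a] assms(3)[of a] by auto

lemma sharp_metric:
  assumes "metric_on U G" "z \<in> U" "linear \<alpha>"
  shows "G z (sharp (G z) \<alpha>) w = \<alpha> w"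
  by (rule sharp_works[OF metric_onD(1)[OF assms(1,2)] metric_on_nondeg[OF assms(1,2)] assms(3)])

lemma differentiable_det:
  fixes A :: "'a::real_normed_vector \<Rightarrow> real^'n^'n"
  assumes "\<And>i j. (\<lambda>z. A z $ i $ j) differentiable (at x)"
  shows "(\<lambda>z. det (A z)) differentiable (at x)"
proof -
  have *: "((\<lambda>z. A z $ i $ j) has_derivative dderiv (\<lambda>z. A z $ i $ j) x) (at x)" for i j
    using assms frechet_derivative_works by blast
  show ?thesis
    unfolding det_def
    by (rule differentiableI, rule has_derivative_sum, rule has_derivative_mult[OF has_derivative_const],
        rule has_derivative_prod, rule *)
qed

text \<open>
  Raising an index amounts to solving a linear system whose matrix is invertible. By Cramer's rule
  the components of the solution are quotients of determinants in the data, and therefore as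
  differentiable as the data.
\<close>

lemma sharp_differentiable:
  fixes G :: "real^'n \<Rightarrow> real^'n \<Rightarrow> real^'n \<Rightarrow> real"
  assumes G: "metric_on U G" and x: "x \<in> U"
    and lin: "\<And>z. z \<in> U \<Longrightarrow> linear (\<alpha> z)"
    and diff: "\<And>w. (\<lambda>z. \<alpha> z w) differentiable (at x)"
  shows "(\<lambda>z. sharp (G z) (\<alpha> z)) differentiable (at x)"
proof -
  \<comment> \<open>Row \<open>i\<close> of \<open>A z *v y = \<beta> z\<close> reads \<open>G z y e\<^sub>i = \<alpha> z e\<^sub>i\<close>.\<close>
  define A where "A z = (\<chi> i j. G z (axis j 1) (axis i 1))" for z
  define \<beta> where "\<beta> z = (\<chi> i. \<alpha> z (axis i 1))" for z
  define Y where "Y z = (\<chi> k. det (\<chi> i j. if j = k then \<beta> z $ i else A z $ i $ j) / det (A z))" for z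
  have Av: "(A z *v y) $ i = G z y (axis i 1)" if "z \<in> U" for z y i
  proof -
    note b = metric_onD(1)[OF G that]
    have "G z y (axis i 1) = G z (\<Sum>j\<in>UNIV. y $ j *s axis j 1) (axis i 1)"
      by (simp add: basis_expansion)
    also have "\<dots> = (\<Sum>j\<in>UNIV. y $ j * G z (axis j 1) (axis i 1))"
      using b unfolding bilinear_def
      by (subst linear_sum[where f = "\<lambda>a. G z a (axis i 1)"])
        (auto simp: bilinear_lmul[OF b] scalar_mult_eq_scaleR)
    also have "\<dots> = (A z *v y) $ i"
      by (simp add: A_def matrix_vector_mult_def mult.commute)
    finally show ?thesis by simp
  qed
  have det: "det (A z) \<noteq> 0" if z: "z \<in> U" for z
  proof -
    have "y = 0" if "A z *v y = 0" for y
    proof (rule metric_on_nondeg[OF G z])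
      note b = metric_onD(1)[OF G z]
      fix w
      have "G z y w = G z y (\<Sum>i\<in>UNIV. w $ i *s axis i 1)"
        by (simp add: basis_expansion)
      also have "\<dots> = (\<Sum>i\<in>UNIV. w $ i * G z y (axis i 1))"
        using b unfolding bilinear_def
        by (subst linear_sum[where f = "G z y"])
          (auto simp: bilinear_rmul[OF b] scalar_mult_eq_scaleR)
      also have "\<dots> = 0"
        unfolding Av[OF z, symmetric] that by simp
      finally show "G z y w = 0" .
    qed
    then have "invertible (A z)"
      using invertible_left_inverse matrix_left_invertible_ker by blast
    then show ?thesis by (simp add: invertible_det_nz)
  qed
  have Y_eq: "Y z = sharp (G z) (\<alpha> z)" if z: "z \<in> U" for z
  proof -
    have "A z *v sharp (G z) (\<alpha> z) = \<beta> z"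
      by (simp add: vec_eq_iff Av[OF z] sharp_metric[OF G z lin[OF z]] \<beta>_def)
    then show ?thesis unfolding Y_def by (simp add: cramer[OF det[OF z]])
  qed
  have "Y differentiable (at x)"
  proof -
    have dA: "(\<lambda>z. A z $ i $ j) differentiable (at x)" for i j
      by (simp add: A_def metric_onD(4)[OF G x])
    have d\<beta>: "(\<lambda>z. \<beta> z $ i) differentiable (at x)" for i
      by (simp add: \<beta>_def diff)
    have dM: "(\<lambda>z. if j = k then \<beta> z $ i else A z $ i $ j) differentiable (at x)" for i j k
      by (cases "j = k") (simp_all add: dA d\<beta>)
    have "(\<lambda>z. det (\<chi> i j. if j = k then \<beta> z $ i else A z $ i $ j) / det (A z)) differentiable (at x)"
      for k
      by (rule differentiable_divide[OF differentiable_det differentiable_det[OF dA] det[OF x]])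
        (simp add: dM)
    then have "(\<lambda>z. Y z $ k) differentiable (at x)" for k
      by (simp add: Y_def)
    then have "(\<lambda>z. Y z \<bullet> i) differentiable (at x)" if "i \<in> Basis" for i
      using that by (auto simp: Basis_vec_def inner_axis)
    then show ?thesis
      unfolding differentiable_componentwise_within[of Y x UNIV] by (intro ballI)
  qed
  then show ?thesis
    by (rule differentiable_cong_open[OF _ metric_on_open[OF G] x Y_eq])
qed

text \<open>
  The Leibniz rule for \<open>G(Y, w)\<close> with constant \<open>w\<close>. Only the numbers \<open>G z i w\<close> are known to depend
  differentiably on \<open>z\<close>, not \<open>G z\<close> as a map; hence \<open>Y\<close> is expanded in the standard basis.
\<close>

lemma has_derivative_metric_pairing:
  fixes G :: "'e::euclidean_space \<Rightarrow> 'e \<Rightarrow> 'e \<Rightarrow> real"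
  assumes G: "metric_on U G" and x: "x \<in> U" and Y: "Y differentiable (at x)"
  shows "((\<lambda>z. G z (Y z) w) has_derivative
    (\<lambda>a. dderiv (\<lambda>z. G z (Y x) w) x a + G x (dderiv Y x a) w)) (at x)"
proof -
  have expand: "G z v w = (\<Sum>i\<in>Basis. (v \<bullet> i) * G z i w)" if "z \<in> U" for z v
  proof -
    note b = metric_onD(1)[OF G that]
    have "G z v w = G z (\<Sum>i\<in>Basis. (v \<bullet> i) *\<^sub>R i) w"
      by (simp add: euclidean_representation)
    also have "\<dots> = (\<Sum>i\<in>Basis. (v \<bullet> i) * G z i w)"
      using b unfolding bilinear_def
      by (subst linear_sum[where f = "\<lambda>a. G z a w"]) (auto simp: bilinear_lmul[OF b])
    finally show ?thesis .
  qed
  have dG: "((\<lambda>z. G z i w) has_derivative dderiv (\<lambda>z. G z i w) x) (at x)" for i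
    using metric_onD(4)[OF G x] frechet_derivative_works by blast
  have dY: "((\<lambda>z. Y z \<bullet> i) has_derivative (\<lambda>a. dderiv Y x a \<bullet> i)) (at x)" for i
    using Y frechet_derivative_works by (intro has_derivative_inner_left) blast
  have "((\<lambda>z. \<Sum>i\<in>Basis. (Y x \<bullet> i) * G z i w) has_derivative
      (\<lambda>a. \<Sum>i\<in>Basis. (Y x \<bullet> i) * dderiv (\<lambda>z. G z i w) x a)) (at x)"
    by (intro has_derivative_sum has_derivative_mult_right dG)
  then have "((\<lambda>z. G z (Y x) w) has_derivative
      (\<lambda>a. \<Sum>i\<in>Basis. (Y x \<bullet> i) * dderiv (\<lambda>z. G z i w) x a)) (at x)"
    by (rule has_derivative_transform_within_open[OF _ metric_on_open[OF G] x])
      (rule expand[symmetric])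
  then have *: "dderiv (\<lambda>z. G z (Y x) w) x a
      = (\<Sum>i\<in>Basis. (Y x \<bullet> i) * dderiv (\<lambda>z. G z i w) x a)" for a
    by (rule dderiv_eqI)
  have "((\<lambda>z. \<Sum>i\<in>Basis. (Y z \<bullet> i) * G z i w) has_derivative
      (\<lambda>a. \<Sum>i\<in>Basis. (Y x \<bullet> i) * dderiv (\<lambda>z. G z i w) x a + (dderiv Y x a \<bullet> i) * G x i w)) (at x)"
    by (intro has_derivative_sum has_derivative_mult dG dY)
  then have "((\<lambda>z. \<Sum>i\<in>Basis. (Y z \<bullet> i) * G z i w) has_derivative
      (\<lambda>a. dderiv (\<lambda>z. G z (Y x) w) x a + G x (dderiv Y x a) w)) (at x)"
    unfolding * expand[OF x, of "dderiv Y x _"] by (simp only: sum.distrib)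
  then show ?thesis
    by (rule has_derivative_transform_within_open[OF _ metric_on_open[OF G] x])
      (rule expand[symmetric])
qed

text \<open>
  The covariant Hessian \<open>\<nabla>df\<close> on the constant vector fields \<open>a\<close> and \<open>b\<close>.
\<close>

definition hessian ::
    "('e::real_normed_vector \<Rightarrow> 'e \<Rightarrow> 'e \<Rightarrow> real) \<Rightarrow> ('e \<Rightarrow> real) \<Rightarrow> 'e \<Rightarrow> 'e \<Rightarrow> 'e \<Rightarrow> real"
  where "hessian G f x a b = dderiv (\<lambda>z. dderiv f z b) x a - dderiv f x (christoffel G x a b)"

text \<open>
  With \<open>Y\<close> the gradient of \<open>f\<close>, metric compatibility turns the derivative of \<open>G(Y, w) = df(w)\<close> into
  \<open>G(\<nabla>\<^sub>a Y, w) = \<nabla>df(a, w)\<close>. Inserting for \<open>w\<close> the vector that represents the \<open>b\<close>-th component gives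
  the diagonal entries of \<open>\<nabla>Y\<close>, whose sum is the divergence.
\<close>

lemma divergence_gradient:
  fixes G :: "real^'n \<Rightarrow> real^'n \<Rightarrow> real^'n \<Rightarrow> real"
  assumes G: "metric_on U G" and x: "x \<in> U"
    and f: "\<And>z. z \<in> U \<Longrightarrow> f differentiable (at z)"
    and f2: "\<And>w. (\<lambda>z. dderiv f z w) differentiable (at x)"
  shows "divergence G (gradient G f) x = metric_trace (G x) (hessian G f x)"
proof -
  define Y where "Y = gradient G f"
  have lin: "linear (\<lambda>w. dderiv f z w)" if "z \<in> U" for z
    using linear_frechet_derivative[OF f[OF that]] .
  have dY: "Y differentiable (at x)"
    unfolding Y_def gradient_def by (rule sharp_differentiable[OF G x lin f2])
  have GY: "G z (Y z) w = dderiv f z w" if "z \<in> U" for z w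
    unfolding Y_def gradient_def by (rule sharp_metric[OF G that lin[OF that]])
  note chr = metric_on_open[OF G] x metric_onD(1)[OF G] metric_onD(2)[OF G]
    metric_on_nondeg[OF G x] metric_onD(4)[OF G x]
  have hess: "G x (cov_deriv G Y x a) w = hessian G f x a w" for a w
  proof -
    note b = metric_onD(1)[OF G x]
    have "((\<lambda>z. dderiv f z w) has_derivative
      (\<lambda>a. dderiv (\<lambda>z. G z (Y x) w) x a + G x (dderiv Y x a) w)) (at x)"
      by (rule has_derivative_transform_within_open[OF has_derivative_metric_pairing[OF G x dY]
            metric_on_open[OF G] x]) (simp add: GY)
    then have "dderiv (\<lambda>z. dderiv f z w) x a = dderiv (\<lambda>z. G z (Y x) w) x a + G x (dderiv Y x a) w"
      by (rule dderiv_eqI)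
    also have "dderiv (\<lambda>z. G z (Y x) w) x a
        = G x (christoffel G x a (Y x)) w + G x (Y x) (christoffel G x a w)"
      by (rule christoffel_metric[OF chr])
    finally show ?thesis
      by (simp add: hessian_def cov_deriv_def bilinear_ladd[OF b] GY[OF x])
  qed
  have "cov_deriv G Y x b \<bullet> b = hessian G f x b (sharp (G x) (\<lambda>w. w \<bullet> b))" for b
  proof -
    have "linear (\<lambda>w. w \<bullet> b)"
      by (rule linearI) (simp_all add: inner_add_left)
    then have "cov_deriv G Y x b \<bullet> b
        = G x (sharp (G x) (\<lambda>w. w \<bullet> b)) (cov_deriv G Y x b)"
      by (rule sharp_metric[OF G x, symmetric])
    also have "\<dots> = G x (cov_deriv G Y x b) (sharp (G x) (\<lambda>w. w \<bullet> b))"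
      by (rule metric_onD(2)[OF G x])
    also have "\<dots> = hessian G f x b (sharp (G x) (\<lambda>w. w \<bullet> b))"
      by (rule hess)
    finally show ?thesis .
  qed
  then show ?thesis
    unfolding divergence_def metric_trace_def Y_def[symmetric] by simp
qed

lemma hessian_locally_constant:
  assumes "open U" "x \<in> U" "\<And>z. z \<in> U \<Longrightarrow> f z = c"
  shows "hessian G f x a b = 0"
proof -
  have *: "dderiv f z w = 0" if "z \<in> U" for z w
    by (subst dderiv_cong_open[OF differentiable_const assms(1) that assms(3)[symmetric]]) simp_all
  have "dderiv (\<lambda>z. dderiv f z b) x a = 0"
    by (subst dderiv_cong_open[OF differentiable_const assms(1,2) *[symmetric]]) simp_all
  then show ?thesis by (simp add: hessian_def *[OF assms(2)])
qed

lemma metric_trace_linear: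
  assumes "linear \<Lambda>"
  shows "\<Lambda> (metric_trace B T) = metric_trace B (\<lambda>a b. \<Lambda> (T a b))"
  by (simp add: metric_trace_def linear_sum[OF assms] o_def)

text \<open>
  Apply \<open>\<Lambda>\<close> to the Gauss formula: the ambient Christoffel term is what distinguishes the result from
  the Hessian of \<open>\<Lambda> \<circ> F\<close> on the submanifold. It is minus the ambient Hessian of \<open>\<Lambda>\<close>, which is assumed
  to vanish on the two tangent vectors concerned.
\<close>

lemma second_fundamental_form_linear:
  assumes \<Lambda>: "bounded_linear \<Lambda>" and U: "open U" "x \<in> U"
    and F: "\<And>z. z \<in> U \<Longrightarrow> F differentiable (at z)"
    and F2: "\<And>w. (\<lambda>z. dderiv F z w) differentiable (at x)"
    and geo: "\<Lambda> (christoffel G' (F x) (dderiv F x a) (dderiv F x b)) = 0"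
  shows "\<Lambda> (second_fundamental_form G' G F x a b) = hessian G (\<lambda>z. \<Lambda> (F z)) x a b"
proof -
  interpret bounded_linear \<Lambda> by (rule \<Lambda>)
  have d: "dderiv (\<lambda>z. \<Lambda> (F z)) z w = \<Lambda> (dderiv F z w)" if "z \<in> U" for z w
    by (rule dderiv_linear_comp[OF \<Lambda> F[OF that]])
  have "dderiv (\<lambda>z. dderiv (\<lambda>z. \<Lambda> (F z)) z b) x a = dderiv (\<lambda>z. \<Lambda> (dderiv F z b)) x a"
    by (rule dderiv_cong_open[OF differentiable_linear_comp[OF \<Lambda> F2] U]) (simp add: d)
  also have "\<dots> = \<Lambda> (dderiv (\<lambda>z. dderiv F z b) x a)"
    by (rule dderiv_linear_comp[OF \<Lambda> F2])
  finally show ?thesis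
    by (simp add: second_fundamental_form_def hessian_def cov_deriv_along_def cov_deriv_def
        add diff geo d U)
qed


section \<open>Charts\<close>

lemma cinv_cmap: "inj_on (cmap c) (cdom c) \<Longrightarrow> p \<in> cdom c \<Longrightarrow> cinv c (cmap c p) = p"
  by (rule inv_into_f_f)

lemma cmap_cinv: "y \<in> cimg c \<Longrightarrow> cmap c (cinv c y) = y"
  by (rule f_inv_into_f)

lemma cinv_in: "y \<in> cimg c \<Longrightarrow> cinv c y \<in> cdom c"
  by (rule inv_into_into)

lemma chart_inj:
  assumes "is_chart T c"
  shows "inj_on (cmap c) (cdom c)"
proof -
  have "cdom c \<subseteq> topspace T"
    using assms by (simp add: is_chart_def openin_subset)
  then have "topspace (subtopology T (cdom c)) = cdom c"
    by (simp add: Int_absorb1)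
  then show ?thesis
    using assms homeomorphic_imp_injective_map unfolding is_chart_def by metis
qed

lemma chart_open_image:
  assumes c: "is_chart T c" and W: "openin T W" "W \<subseteq> cdom c"
  shows "open (cmap c ` W)"
proof -
  have "openin (subtopology T (cdom c)) W"
    using W by (auto simp: openin_subtopology)
  then have "openin (top_of_set (cimg c)) (cmap c ` W)"
    using c homeomorphic_imp_open_map unfolding is_chart_def open_map_def by blast
  then show ?thesis
    using c unfolding is_chart_def by (simp add: openin_open_eq)
qed

lemma differentiable_change_chart:
  assumes inj: "inj_on (cmap c) (cdom c)" "inj_on (cmap d) (cdom d)"
    and p: "p \<in> cdom c" "p \<in> cdom d"
    and opn: "open (cmap c ` (cdom c \<inter> cdom d))"
    and T: "(cmap d \<circ> cinv c) differentiable (at (cmap c p))"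
    and f: "(f \<circ> cinv d) differentiable (at (cmap d p))"
  shows "(f \<circ> cinv c) differentiable (at (cmap c p))"
proof (rule differentiable_cong_open[OF _ opn])
  show "((f \<circ> cinv d) \<circ> (cmap d \<circ> cinv c)) differentiable (at (cmap c p))"
    using T f by (intro differentiable_chain_at) (simp_all add: cinv_cmap[OF inj(1) p(1)])
  show "cmap c p \<in> cmap c ` (cdom c \<inter> cdom d)" using p by blast
  show "((f \<circ> cinv d) \<circ> (cmap d \<circ> cinv c)) z = (f \<circ> cinv c) z"
    if "z \<in> cmap c ` (cdom c \<inter> cdom d)" for z
    using that by (auto simp: cinv_cmap[OF inj(1)] cinv_cmap[OF inj(2)])
qed

lemma smooth_manifold_chart: "smooth_manifold M \<Longrightarrow> c \<in> atlas M \<Longrightarrow> is_chart (mtop M) c"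
  by (simp add: smooth_manifold_def)

lemma smooth_manifold_inj:
  "smooth_manifold M \<Longrightarrow> c \<in> atlas M \<Longrightarrow> inj_on (cmap c) (cdom c)"
  by (meson smooth_manifold_chart chart_inj)

lemma smooth_manifold_open_cimg: "smooth_manifold M \<Longrightarrow> c \<in> atlas M \<Longrightarrow> open (cimg c)"
  using smooth_manifold_chart is_chart_def by blast

lemma smooth_manifold_cdom: "smooth_manifold M \<Longrightarrow> c \<in> atlas M \<Longrightarrow> p \<in> cdom c \<Longrightarrow> p \<in> topspace (mtop M)"
  unfolding smooth_manifold_def by blast

lemma smooth_manifold_overlap:
  assumes "smooth_manifold M" "c \<in> atlas M" "d \<in> atlas M"
  shows "open (cmap c ` (cdom c \<inter> cdom d))"
    and "p \<in> cdom c \<Longrightarrow> p \<in> cdom d \<Longrightarrow> (cmap d \<circ> cinv c) differentiable (at (cmap c p))"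
proof -
  have "openin (mtop M) (cdom c \<inter> cdom d)"
    using assms smooth_manifold_chart is_chart_def by blast
  then show "open (cmap c ` (cdom c \<inter> cdom d))"
    by (intro chart_open_image[OF smooth_manifold_chart[OF assms(1,2)]]) auto
  have "smooth_on (cmap c ` (cdom c \<inter> cdom d)) (cmap d \<circ> cinv c)"
    using assms unfolding smooth_manifold_def by blast
  then show "(cmap d \<circ> cinv c) differentiable (at (cmap c p))" if "p \<in> cdom c" "p \<in> cdom d"
    using that by (intro smooth_on_differentiable) auto
qed

lemma chart_at_works:
  assumes "\<exists>c\<in>atlas M. p \<in> cdom c"
  shows "chart_at M p \<in> atlas M" "p \<in> cdom (chart_at M p)"
  using someI_ex[of "\<lambda>c. c \<in> atlas M \<and> p \<in> cdom c"] assms unfolding chart_at_def by blast+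

text \<open>
  Smoothness near a point is witnessed by some chart, whereas coordinate vectors differentiate in a
  prescribed one. The lemma moves from the former to the latter.
\<close>

lemma smooth_near_differentiable:
  assumes M: "smooth_manifold M" and c: "c \<in> atlas M" "p \<in> cdom c" and f: "smooth_near M p f"
  shows "(f \<circ> cinv c) differentiable (at (cmap c p))"
proof -
  obtain d W where d: "d \<in> atlas M" "p \<in> cdom d"
    and W: "cmap d p \<in> W" "smooth_on W (f \<circ> cinv d)"
    using f unfolding smooth_near_def by blast
  show ?thesis
    by (rule differentiable_change_chart[OF smooth_manifold_inj[OF M c(1)]
          smooth_manifold_inj[OF M d(1)] c(2) d(2) smooth_manifold_overlap[OF M c(1) d(1)]
          smooth_on_differentiable[OF W(2,1)]]) (rule c d)+
qed

lemma riemannian_metric_on: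
  assumes "smooth_manifold M" "riemannian_metric M g" "c \<in> atlas M"
  shows "metric_on (cimg c) (in_chart M g c)"
  using assms smooth_manifold_open_cimg[OF assms(1,3)]
  unfolding metric_on_def riemannian_metric_def by (blast intro: smooth_on_differentiable)

section \<open>Product charts of a plane fronted wave\<close>

text \<open>
  All charts of a plane fronted wave have this form, since the identity is the only chart of the
  plane.
\<close>

definition wave_chart :: "('m, 'e) chart \<Rightarrow> ((real \<times> real) \<times> 'm, (real \<times> real) \<times> 'e) chart"
  where "wave_chart c = (UNIV \<times> cdom c, map_prod (\<lambda>w. w) (cmap c))"

lemma cdom_wave_chart [simp]: "cdom (wave_chart c) = UNIV \<times> cdom c"
  by (simp add: wave_chart_def)

lemma cmap_wave_chart [simp]: "cmap (wave_chart c) = map_prod (\<lambda>w. w) (cmap c)"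
  by (simp add: wave_chart_def)

lemma image_wave_chart: "map_prod (\<lambda>w. w) (cmap c) ` (UNIV \<times> A) = UNIV \<times> cmap c ` A"
  by auto

lemma inj_wave_chart:
  "inj_on (cmap c) (cdom c) \<Longrightarrow> inj_on (cmap (wave_chart c)) (cdom (wave_chart c))"
  by (auto simp: inj_on_def)

lemma cinv_wave_chart [unfolded cdom_wave_chart cmap_wave_chart]:
  assumes "inj_on (cmap c) (cdom c)" "y \<in> cimg c"
  shows "cinv (wave_chart c) (w, y) = (w, cinv c y)"
proof (rule inv_into_f_eq[OF inj_wave_chart[OF assms(1)]])
  show "(w, cinv c y) \<in> cdom (wave_chart c)" using cinv_in[OF assms(2)] by simp
  show "cmap (wave_chart c) (w, cinv c y) = (w, y)" using cmap_cinv[OF assms(2)] by simp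
qed

lemma atlas_pfw:
  fixes M :: "('m, 'e::euclidean_space) manifold"
  shows "atlas (pfw_manifold M) = wave_chart ` atlas M"
proof -
  have "(\<exists>c d. e = (cdom c \<times> cdom d, map_prod (cmap c) (cmap d)) \<and> c \<in> {(UNIV, \<lambda>x. x)} \<and> d \<in> A)
      \<longleftrightarrow> (\<exists>d\<in>A. e = wave_chart d)" for A :: "('m, 'e) chart set" and e
    unfolding wave_chart_def singleton_iff by (metis fst_conv snd_conv)
  then show ?thesis
    by (auto simp: pfw_manifold_def prod_manifold_def euclidean_manifold_def image_iff)
qed

lemma topspace_pfw: "topspace (mtop (pfw_manifold M)) = UNIV \<times> topspace (mtop M)"
  by (simp add: pfw_manifold_def prod_manifold_def euclidean_manifold_def)

lemma openin_cdom_wave_chart: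
  assumes "openin (mtop M) (cdom c)"
  shows "openin (mtop (pfw_manifold M)) (cdom (wave_chart c))"
  using assms
  by (simp add: pfw_manifold_def prod_manifold_def euclidean_manifold_def openin_prod_Times_iff)

text \<open>
  The counterpart of \<open>smooth_near_differentiable\<close> for the product manifold: the transition maps are
  the identity on the plane and those of \<open>M\<close> on the second factor.
\<close>

lemma wave_smooth_near_differentiable:
  fixes M :: "('m, 'e::euclidean_space) manifold"
  assumes M: "smooth_manifold M" and c: "c \<in> atlas M" "x \<in> cdom c"
    and f: "smooth_near (pfw_manifold M) (w, x) f"
  shows "(f \<circ> cinv (wave_chart c)) differentiable (at (w, cmap c x))"
proof -
  obtain e W where e: "e \<in> wave_chart ` atlas M" "(w, x) \<in> cdom e"
    and eW: "cmap e (w, x) \<in> W" "smooth_on W (f \<circ> cinv e)"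
    using f unfolding smooth_near_def atlas_pfw by blast
  from e obtain d where d1: "d \<in> atlas M" and ed: "e = wave_chart d"
    by blast
  have d: "d \<in> atlas M" "x \<in> cdom d"
    using d1 e(2) by (simp_all add: ed)
  note W = eW[unfolded ed]
  note inj = smooth_manifold_inj[OF M c(1)] smooth_manifold_inj[OF M d(1)]
  note T = smooth_manifold_overlap[OF M c(1) d(1)]
  let ?A = "UNIV \<times> cmap c ` (cdom c \<inter> cdom d) :: ((real \<times> real) \<times> 'e) set"
  have im: "cmap (wave_chart c) ` (cdom (wave_chart c) \<inter> cdom (wave_chart d)) = ?A"
    by auto
  have opn: "open ?A" by (intro open_Times open_UNIV T)
  have "(\<lambda>z. (fst z, (cmap d \<circ> cinv c) (snd z))) differentiable (at (w, cmap c x))"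
  proof -
    have "(\<lambda>z. (cmap d \<circ> cinv c) (snd z)) differentiable (at (w, cmap c x))"
      by (rule differentiable_comp_linear[OF bounded_linear_snd]) (use T(2)[OF c(2) d(2)] in \<open>simp add: comp_def\<close>)
    then obtain D where "((\<lambda>z. (cmap d \<circ> cinv c) (snd z)) has_derivative D) (at (w, cmap c x))"
      unfolding differentiable_def by blast
    then show ?thesis
      by (rule differentiableI[OF has_derivative_Pair[OF
              bounded_linear_imp_has_derivative[OF bounded_linear_fst]]])
  qed
  then have "(cmap (wave_chart d) \<circ> cinv (wave_chart c)) differentiable (at (w, cmap c x))"
  proof (rule differentiable_cong_open[OF _ opn])
    show "(w, cmap c x) \<in> ?A" using c d by blast
    show "(fst z, (cmap d \<circ> cinv c) (snd z)) = (cmap (wave_chart d) \<circ> cinv (wave_chart c)) z"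
      if "z \<in> ?A" for z
      using that cinv_wave_chart[OF inj(1), of "snd z" "fst z"] by auto
  qed
  then show ?thesis
    using differentiable_change_chart[OF inj_wave_chart[OF inj(1)] inj_wave_chart[OF inj(2)],
        of "(w, x)" f] c(2) d(2) opn[folded im] smooth_on_differentiable[OF W(2,1)] by auto
qed

text \<open>
  In a product chart, a linear function of \<open>(u, v)\<close> remains that linear function. Smoothness has to be
  established since a tangent vector is \<open>0\<close> by convention on functions that are not smooth.
\<close>

lemma smooth_near_wave_linear:
  assumes M: "smooth_manifold M" and x: "x \<in> topspace (mtop M)" and L: "bounded_linear L"
    and f: "\<And>w y. f (w, y) = L w"
  shows "smooth_near (pfw_manifold M) (w, x) f"
proof -
  obtain c where c: "c \<in> atlas M" "x \<in> cdom c"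
    using M x unfolding smooth_manifold_def by blast
  note inj = smooth_manifold_inj[OF M c(1)]
  let ?W = "UNIV \<times> cimg c"
  have opn: "open ?W" by (intro open_Times open_UNIV smooth_manifold_open_cimg[OF M c(1)])
  have "smooth_on ?W (f \<circ> cinv (wave_chart c))"
    unfolding smooth_on_def
  proof
    fix k
    show "Ck_on k ?W (f \<circ> cinv (wave_chart c))"
      by (rule Ck_on_cong[OF Ck_on_bounded_linear[OF bounded_linear_compose[OF L bounded_linear_fst]] opn])
        (auto simp: cinv_wave_chart[OF inj] f)
  qed
  then show ?thesis
    unfolding smooth_near_def atlas_pfw using c opn
    by (intro bexI[of _ "wave_chart c"] conjI exI[of _ ?W]) (auto simp: image_wave_chart)
qed

lemma smooth_near_snd:
  fixes M :: "('m, 'e::euclidean_space) manifold"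
  assumes M: "smooth_manifold M" and f: "smooth_near M x f"
  shows "smooth_near (pfw_manifold M) (w, x) (f \<circ> snd)"
proof -
  obtain c W where c: "c \<in> atlas M" "x \<in> cdom c"
    and W: "open W" "cmap c x \<in> W" "W \<subseteq> cimg c" "smooth_on W (f \<circ> cinv c)"
    using f unfolding smooth_near_def by blast
  note inj = smooth_manifold_inj[OF M c(1)]
  let ?W = "UNIV \<times> W :: ((real \<times> real) \<times> 'e) set"
  have opn: "open ?W" by (intro open_Times open_UNIV W)
  have "smooth_on ?W ((f \<circ> snd) \<circ> cinv (wave_chart c))"
    unfolding smooth_on_def
  proof
    fix k
    have "Ck_on k (snd -` W) (\<lambda>z. (f \<circ> cinv c) (snd z))"
      by (rule Ck_on_comp_linear[OF bounded_linear_snd W(1)])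
        (rule W(4)[unfolded smooth_on_def, rule_format])
    then have "Ck_on k ?W (\<lambda>z. (f \<circ> cinv c) (snd z))"
      by (rule Ck_on_subset) auto
    then show "Ck_on k ?W ((f \<circ> snd) \<circ> cinv (wave_chart c))"
      by (rule Ck_on_cong[OF _ opn]) (use W(3) in \<open>auto simp: cinv_wave_chart[OF inj]\<close>)
  qed
  then show ?thesis
    unfolding smooth_near_def atlas_pfw using c opn W
    by (intro bexI[of _ "wave_chart c"] conjI exI[of _ ?W]) (auto simp: image_wave_chart)
qed

lemma coord_vec_wave_linear:
  assumes M: "smooth_manifold M" and c: "c \<in> atlas M" "x \<in> cdom c" and L: "bounded_linear L"
    and f: "\<And>w y. f (w, y) = L w"
  shows "coord_vec (pfw_manifold M) (wave_chart c) (w, x) a f = L (fst a)"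
proof -
  note inj = smooth_manifold_inj[OF M c(1)]
  have "((L \<circ> fst) has_derivative (L \<circ> fst)) (at (w, cmap c x))"
    unfolding comp_def
    by (rule bounded_linear_imp_has_derivative[OF bounded_linear_compose[OF L bounded_linear_fst]])
  then have "((f \<circ> cinv (wave_chart c)) has_derivative (L \<circ> fst)) (at (w, cmap c x))"
  proof (rule has_derivative_transform_within_open)
    show "open (UNIV \<times> cimg c)"
      by (rule open_Times[OF open_UNIV smooth_manifold_open_cimg[OF M c(1)]])
    show "(w, cmap c x) \<in> UNIV \<times> cimg c" using c by simp
    show "(L \<circ> fst) z = (f \<circ> cinv (wave_chart c)) z" if "z \<in> UNIV \<times> cimg c" for z
      using that by (auto simp: cinv_wave_chart[OF inj] f)
  qed
  then have "dderiv (f \<circ> cinv (wave_chart c)) (w, cmap c x) a = (L \<circ> fst) a"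
    by (rule dderiv_eqI)
  then show ?thesis
    using smooth_near_wave_linear[OF M smooth_manifold_cdom[OF M c] L f]
    by (simp add: coord_vec_def)
qed

lemma coord_vec_wave_coordinates:
  assumes M: "smooth_manifold M" and c: "c \<in> atlas M" "x \<in> cdom c"
  shows "coord_vec (pfw_manifold M) (wave_chart c) (w, x) a coord_u = fst (fst a)"
    and "coord_vec (pfw_manifold M) (wave_chart c) (w, x) a coord_v = snd (fst a)"
  by (rule coord_vec_wave_linear[OF M c bounded_linear_fst], simp add: coord_u_def split: prod.split)
    (rule coord_vec_wave_linear[OF M c bounded_linear_snd], simp add: coord_v_def split: prod.split)

lemma pushforward_snd_coord_vec_wave:
  assumes M: "smooth_manifold M" and c: "c \<in> atlas M" "x \<in> cdom c"
  shows "pushforward M snd (w, x) (coord_vec (pfw_manifold M) (wave_chart c) (w, x) a)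
    = coord_vec M c x (snd a)"
proof
  fix f
  note inj = smooth_manifold_inj[OF M c(1)]
  have "dderiv ((f \<circ> snd) \<circ> cinv (wave_chart c)) (w, cmap c x) a = dderiv (f \<circ> cinv c) (cmap c x) (snd a)"
    if f: "smooth_near M x f"
  proof -
    note df = smooth_near_differentiable[OF M c f]
    have "dderiv ((f \<circ> snd) \<circ> cinv (wave_chart c)) (w, cmap c x) a
        = dderiv (\<lambda>z. (f \<circ> cinv c) (snd z)) (w, cmap c x) a"
    proof (rule dderiv_cong_open)
      show "(\<lambda>z. (f \<circ> cinv c) (snd z)) differentiable (at (w, cmap c x))"
        by (rule differentiable_comp_linear[OF bounded_linear_snd]) (use df in \<open>simp add: comp_def\<close>)
      show "open (UNIV \<times> cimg c)"
        by (rule open_Times[OF open_UNIV smooth_manifold_open_cimg[OF M c(1)]])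
      show "(w, cmap c x) \<in> UNIV \<times> cimg c" using c by simp
      show "(f \<circ> cinv c) (snd z) = ((f \<circ> snd) \<circ> cinv (wave_chart c)) z"
        if "z \<in> UNIV \<times> cimg c" for z
        using that cinv_wave_chart[OF inj, of "snd z" "fst z"] by auto
    qed
    also have "\<dots> = dderiv (f \<circ> cinv c) (cmap c x) (snd a)"
      using dderiv_comp_linear[OF bounded_linear_snd, of "f \<circ> cinv c" "(w, cmap c x)" a] df by simp
    finally show ?thesis .
  qed
  then show "pushforward M snd (w, x) (coord_vec (pfw_manifold M) (wave_chart c) (w, x) a) f
      = coord_vec M c x (snd a) f"
    using smooth_near_snd[OF M, of x f w] by (simp add: pushforward_def coord_vec_def)
qed

lemma partial_v_eq_coord_vec:
  assumes M: "smooth_manifold M" and c: "c \<in> atlas M" "x \<in> cdom c"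
  shows "partial_v M (w, x) = coord_vec (pfw_manifold M) (wave_chart c) (w, x) ((0, 1), 0)"
proof
  fix f
  note inj = smooth_manifold_inj[OF M c(1)]
  obtain u v where w: "w = (u, v)" by fastforce
  have "deriv (f \<circ> (\<lambda>s. ((u, s), x))) v = dderiv (f \<circ> cinv (wave_chart c)) ((u, v), cmap c x) ((0, 1), 0)"
    if f: "smooth_near (pfw_manifold M) ((u, v), x) f"
  proof -
    let ?D = "dderiv (f \<circ> cinv (wave_chart c)) ((u, v), cmap c x)"
    have df: "((f \<circ> cinv (wave_chart c)) has_derivative ?D) (at ((u, v), cmap c x))"
      using wave_smooth_near_differentiable[OF M c f] frechet_derivative_works by blast
    have "((\<lambda>s. ((u, s), cmap c x)) has_derivative (\<lambda>s. ((0, s), 0))) (at v)"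
      by (intro has_derivative_Pair has_derivative_const has_derivative_ident)
    from diff_chain_at[OF this df]
    have drv: "((f \<circ> (\<lambda>s. ((u, s), x))) has_derivative (\<lambda>s. ?D ((0, s), 0))) (at v)"
      using c by (simp add: comp_def cinv_wave_chart[OF inj] cinv_cmap[OF inj])
    have "?D ((0, s), 0) = ?D ((0, 1), 0) * s" for s
      using linear_cmul[OF has_derivative_linear[OF df], of s "((0, 1), 0)"]
      by (simp add: scaleR_prod_def mult.commute)
    then have "(\<lambda>s. ?D ((0, s), 0)) = (*) (?D ((0, 1), 0))"
      by (rule ext)
    then have "((f \<circ> (\<lambda>s. ((u, s), x))) has_field_derivative ?D ((0, 1), 0)) (at v)"
      using drv by (simp only: has_field_derivative_def)
    then show ?thesis by (rule DERIV_imp_deriv)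
  qed
  then show "partial_v M (w, x) f = coord_vec (pfw_manifold M) (wave_chart c) (w, x) ((0, 1), 0) f"
    by (simp add: w partial_v_def velocity_def coord_vec_def)
qed


section \<open>The metric of a plane fronted wave in coordinates\<close>

text \<open>
  The value at one point of the metric \<open>h du\<^sup>2 + 2 du dv + \<gamma>\<close>, on vectors \<open>((a\<^sub>u, a\<^sub>v), a\<^sub>M)\<close> given by their
  components in a product chart.
\<close>

definition wave_form ::
    "real \<Rightarrow> ('e \<Rightarrow> 'e \<Rightarrow> real) \<Rightarrow> (real \<times> real) \<times> 'e \<Rightarrow> (real \<times> real) \<times> 'e \<Rightarrow> real"
  where "wave_form h \<gamma> a b = h * (fst (fst a) * fst (fst b)) + fst (fst a) * snd (fst b)
    + snd (fst a) * fst (fst b) + \<gamma> (snd a) (snd b)"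

lemma wave_form_sym: "(\<And>y z. \<gamma> y z = \<gamma> z y) \<Longrightarrow> wave_form h \<gamma> a b = wave_form h \<gamma> b a"
  by (simp add: wave_form_def mult.commute)

lemma bilinear_wave_form:
  assumes "bilinear \<gamma>"
  shows "bilinear (wave_form h \<gamma>)"
  unfolding bilinear_def
  by (intro conjI allI linearI)
    (simp_all add: wave_form_def bilinear_ladd[OF assms] bilinear_radd[OF assms]
      bilinear_lmul[OF assms] bilinear_rmul[OF assms] algebra_simps)

lemma wave_form_partial_v:
  "bilinear \<gamma> \<Longrightarrow> wave_form h \<gamma> a ((0, 1), 0) = fst (fst a)"
  by (simp add: wave_form_def bilinear_rzero)

lemma wave_form_partial_u:
  "bilinear \<gamma> \<Longrightarrow> wave_form h \<gamma> a ((1, 0), 0) = h * fst (fst a) + snd (fst a)"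
  by (simp add: wave_form_def bilinear_rzero)

lemma wave_form_nondeg:
  assumes \<gamma>: "bilinear \<gamma>" "\<And>y. y \<noteq> 0 \<Longrightarrow> \<gamma> y y > 0"
    and a: "\<And>b. wave_form h \<gamma> a b = 0"
  shows "a = 0"
proof -
  have u: "fst (fst a) = 0" using a[of "((0, 1), 0)"] wave_form_partial_v[OF \<gamma>(1)] by simp
  have v: "snd (fst a) = 0" using a[of "((1, 0), 0)"] wave_form_partial_u[OF \<gamma>(1)] u by simp
  have "\<gamma> (snd a) (snd a) = 0" using a[of a] u v by (simp add: wave_form_def)
  then have "snd a = 0" using \<gamma>(2)[of "snd a"] by fastforce
  with u v show ?thesis by (simp add: prod_eq_iff)
qed

text \<open>
  Two causal vectors in the same time cone have a nonpositive product, here for \<open>a\<close> and \<open>\<partial>\<^sub>v\<close>, where the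
  cone is singled out by a timelike vector \<open>t\<close>. Otherwise a combination of \<open>t\<close> and \<open>a\<close> with positive
  coefficients would have vanishing \<open>u\<close>-component. Such a vector is not timelike, but a positive
  combination of \<open>t\<close> and \<open>a\<close> is.
\<close>

lemma wave_form_timecone:
  assumes \<gamma>: "bilinear \<gamma>" "\<And>y z. \<gamma> y z = \<gamma> z y" "\<And>y. y \<noteq> 0 \<Longrightarrow> \<gamma> y y > 0"
    and t: "wave_form h \<gamma> t t < 0" "fst (fst t) < 0"
    and a: "wave_form h \<gamma> a a \<le> 0" "wave_form h \<gamma> t a < 0"
  shows "fst (fst a) \<le> 0"
proof (rule ccontr)
  assume "\<not> fst (fst a) \<le> 0"
  define r s where "r = fst (fst a)" and "s = - fst (fst t)"
  have r: "r > 0" and s: "s > 0"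
    using \<open>\<not> _\<close> t(2) by (simp_all add: r_def s_def)
  note bil = bilinear_wave_form[OF \<gamma>(1), of h]
  have sym: "wave_form h \<gamma> b c = wave_form h \<gamma> c b" for b c
    by (rule wave_form_sym[OF \<gamma>(2)])
  define w where "w = r *\<^sub>R t + s *\<^sub>R a"
  have "fst (fst w) = 0" by (simp add: w_def r_def s_def)
  then have "wave_form h \<gamma> w w = \<gamma> (snd w) (snd w)" by (simp add: wave_form_def)
  also have "\<dots> \<ge> 0"
    using \<gamma>(3)[of "snd w"] bilinear_lzero[OF \<gamma>(1)] by (cases "snd w = 0") (auto intro: less_imp_le)
  finally have "wave_form h \<gamma> w w \<ge> 0" .
  moreover have "wave_form h \<gamma> w w = r * r * wave_form h \<gamma> t t + 2 * (r * s * wave_form h \<gamma> t a)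
      + s * s * wave_form h \<gamma> a a"
    unfolding w_def bilinear_ladd[OF bil] bilinear_radd[OF bil] bilinear_lmul[OF bil]
      bilinear_rmul[OF bil] sym[of a t] by (simp add: algebra_simps)
  moreover have "r * r * wave_form h \<gamma> t t < 0" "r * s * wave_form h \<gamma> t a < 0"
    "s * s * wave_form h \<gamma> a a \<le> 0"
    using r s t a by (simp_all add: mult_pos_neg mult_nonneg_nonpos)
  ultimately show False by linarith
qed

text \<open>
  On the hyperplane \<open>du = 0\<close> the metric is the pullback of the positive definite \<open>\<gamma>\<close>, so that its causal
  vectors are multiples of \<open>\<partial>\<^sub>v\<close>.
\<close>

lemma wave_form_causal_null:
  assumes "\<And>y. y \<noteq> 0 \<Longrightarrow> \<gamma> y y > 0" "fst (fst a) = 0" "wave_form h \<gamma> a a \<le> 0"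
  shows "snd a = 0"
  using assms(1)[of "snd a"] assms(2,3) by (fastforce simp: wave_form_def)

lemma pfw_metric_coord_vec:
  assumes M: "smooth_manifold M" and c: "c \<in> atlas M" "x \<in> cdom c"
  shows "pfw_metric M g \<H> (w, x) (coord_vec (pfw_manifold M) (wave_chart c) (w, x) a)
      (coord_vec (pfw_manifold M) (wave_chart c) (w, x) b)
    = wave_form (\<H> (fst w) x) (in_chart M g c (cmap c x)) a b"
proof -
  obtain u v where w: "w = (u, v)" by fastforce
  show ?thesis
    unfolding w using coord_vec_wave_coordinates[OF M c, of "(u, v)"]
      pushforward_snd_coord_vec_wave[OF M c, of "(u, v)"] cinv_cmap[OF smooth_manifold_inj[OF M c(1)] c(2)]
    by (simp add: pfw_metric_def wave_form_def in_chart_def)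
qed

lemma in_chart_pfw_metric:
  assumes M: "smooth_manifold M" and c: "c \<in> atlas M" and z: "z \<in> UNIV \<times> cimg c"
  shows "in_chart (pfw_manifold M) (pfw_metric M g \<H>) (wave_chart c) z
    = wave_form (\<H> (fst (fst z)) (cinv c (snd z))) (in_chart M g c (snd z))"
proof (intro ext)
  fix a b
  obtain w y where wy: "z = (w, y)" "y \<in> cimg c" using z by (cases z) auto
  show "in_chart (pfw_manifold M) (pfw_metric M g \<H>) (wave_chart c) z a b
    = wave_form (\<H> (fst (fst z)) (cinv c (snd z))) (in_chart M g c (snd z)) a b"
    using pfw_metric_coord_vec[OF M c cinv_in[OF wy(2)], of g \<H> w a b]
    by (simp add: in_chart_def wy cinv_wave_chart[OF smooth_manifold_inj[OF M c] wy(2)] cmap_cinv)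
qed

text \<open>
  The Christoffel symbols of the ambient metric are not computed in full: their \<open>u\<close>-component is the
  product with \<open>\<partial>\<^sub>v\<close>, and then their \<open>v\<close>-component the product with \<open>\<partial>\<^sub>u\<close>. Koszul's formula gives these
  products, and each of its three terms vanishes because a coefficient is constant or does not
  depend on the coordinate in question. The description of \<open>G'\<close> is only required over \<open>U\<close>, as the
  inverse of a chart is arbitrary outside its image.
\<close>

context
  fixes G' :: "(real \<times> real) \<times> 'e::euclidean_space \<Rightarrow> (real \<times> real) \<times> 'e \<Rightarrow> (real \<times> real) \<times> 'e \<Rightarrow> real"
    and h :: "real \<Rightarrow> 'e \<Rightarrow> real" and \<gamma> :: "'e \<Rightarrow> 'e \<Rightarrow> 'e \<Rightarrow> real" and U :: "'e set"
    and z0 :: "(real \<times> real) \<times> 'e"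
  assumes G': "\<And>z. z \<in> UNIV \<times> U \<Longrightarrow> G' z = wave_form (h (fst (fst z)) (snd z)) (\<gamma> (snd z))"
    and \<gamma>: "metric_on U \<gamma>" and z0: "z0 \<in> UNIV \<times> U"
    and h: "(\<lambda>z. h (fst (fst z)) (snd z)) differentiable (at z0)"
begin

private lemma opn: "open (UNIV \<times> U :: ((real \<times> real) \<times> 'e) set)"
  by (intro open_Times open_UNIV metric_on_open[OF \<gamma>])

private lemma z0': "snd z0 \<in> U"
  using z0 by auto

private lemma wave_form_differentiable: "(\<lambda>z. G' z a b) differentiable (at z0)"
proof (rule differentiable_cong_open[OF _ opn z0])
  have "(\<lambda>z. \<gamma> (snd z) (snd a) (snd b)) differentiable (at z0)"
    by (rule differentiable_comp_linear[OF bounded_linear_snd]) (rule metric_onD(4)[OF \<gamma> z0'])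
  then show "(\<lambda>z. wave_form (h (fst (fst z)) (snd z)) (\<gamma> (snd z)) a b) differentiable (at z0)"
    unfolding wave_form_def
    by (rule differentiable_add[rotated]) (simp add: h differentiable_mult)
qed (simp add: G')

private lemma koszul:
  "G' z0 (christoffel G' z0 a b) w =
    (dderiv (\<lambda>z. G' z b w) z0 a + dderiv (\<lambda>z. G' z a w) z0 b - dderiv (\<lambda>z. G' z a b) z0 w) / 2"
proof (rule christoffel_koszul[OF opn z0 _ _ _ wave_form_differentiable])
  fix z a b :: "(real \<times> real) \<times> 'e"
  assume z: "z \<in> UNIV \<times> U"
  then have z': "snd z \<in> U" by auto
  show "bilinear (G' z)"
    unfolding G'[OF z] by (rule bilinear_wave_form[OF metric_onD(1)[OF \<gamma> z']])
  show "G' z a b = G' z b a"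
    unfolding G'[OF z] by (rule wave_form_sym[OF metric_onD(2)[OF \<gamma> z']])
next
  fix a assume a: "\<And>b. G' z0 a b = 0"
  show "a = 0"
    by (rule wave_form_nondeg[OF metric_onD(1,3)[OF \<gamma> z0'] a[unfolded G'[OF z0]]])
qed

private lemma dderiv_constant:
  assumes "\<And>z. z \<in> UNIV \<times> U \<Longrightarrow> G' z a b = c"
  shows "dderiv (\<lambda>z. G' z a b) z0 w = 0"
  by (subst dderiv_cong_open[OF differentiable_const opn z0 assms[symmetric]]) simp_all

private lemma dderiv_invariant:
  assumes "\<And>z r. z \<in> UNIV \<times> U \<Longrightarrow> G' (z + r *\<^sub>R w) a b = G' z a b"
  shows "dderiv (\<lambda>z. G' z a b) z0 w = 0"
proof -
  let ?D = "dderiv (\<lambda>z. G' z a b) z0"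
  have "((\<lambda>r. z0 + r *\<^sub>R w) has_derivative (\<lambda>r. r *\<^sub>R w)) (at 0)"
    by (auto intro!: derivative_eq_intros)
  moreover have "((\<lambda>z. G' z a b) has_derivative ?D) (at (z0 + 0 *\<^sub>R w))"
    using wave_form_differentiable frechet_derivative_works by (simp, blast)
  ultimately have "((\<lambda>r. G' (z0 + r *\<^sub>R w) a b) has_derivative (\<lambda>r. ?D (r *\<^sub>R w))) (at 0)"
    using diff_chain_at[of "\<lambda>r. z0 + r *\<^sub>R w" _ 0 "\<lambda>z. G' z a b" ?D] by (simp add: comp_def)
  then have "((\<lambda>r::real. G' z0 a b) has_derivative (\<lambda>r. ?D (r *\<^sub>R w))) (at 0)"
    by (simp add: assms[OF z0])
  then have "(\<lambda>r::real. ?D (r *\<^sub>R w)) = (\<lambda>r. 0)"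
    using has_derivative_unique has_derivative_const by blast
  from fun_cong[OF this, of 1] show ?thesis by simp
qed

lemma christoffel_wave_u: "fst (fst (christoffel G' z0 a b)) = 0"
proof -
  have v: "G' z c ((0, 1), 0) = fst (fst c)" if "z \<in> UNIV \<times> U" for z c
    unfolding G'[OF that] using that by (intro wave_form_partial_v metric_onD(1)[OF \<gamma>]) auto
  have "dderiv (\<lambda>z. G' z a b) z0 ((0, 1), 0) = 0"
  proof (rule dderiv_invariant)
    fix z :: "(real \<times> real) \<times> 'e" and r :: real
    assume z: "z \<in> UNIV \<times> U"
    then have "z + r *\<^sub>R ((0, 1), 0) \<in> UNIV \<times> U" by (cases z) (auto simp: scaleR_prod_def)
    then show "G' (z + r *\<^sub>R ((0, 1), 0)) a b = G' z a b"
      using z by (simp add: G' scaleR_prod_def)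
  qed
  then have "G' z0 (christoffel G' z0 a b) ((0, 1), 0) = 0"
    unfolding koszul by (simp add: dderiv_constant[OF v])
  then show ?thesis by (simp only: v[OF z0])
qed

text \<open>
  On constant fields with vanishing \<open>u\<close>-component, \<open>h\<close> does not enter the metric, and with it
  the only dependence on \<open>u\<close> disappears.
\<close>

lemma christoffel_wave_v:
  assumes "fst (fst a) = 0" "fst (fst b) = 0"
  shows "snd (fst (christoffel G' z0 a b)) = 0"
proof -
  have u: "G' z c ((1, 0), 0) = h (fst (fst z)) (snd z) * fst (fst c) + snd (fst c)"
    if "z \<in> UNIV \<times> U" for z c
    unfolding G'[OF that] using that by (intro wave_form_partial_u metric_onD(1)[OF \<gamma>]) auto
  have const: "dderiv (\<lambda>z. G' z c ((1, 0), 0)) z0 w = 0" if "fst (fst c) = 0" for c w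
    by (rule dderiv_constant[where c = "snd (fst c)"]) (simp add: u that)
  have "dderiv (\<lambda>z. G' z a b) z0 ((1, 0), 0) = 0"
  proof (rule dderiv_invariant)
    fix z :: "(real \<times> real) \<times> 'e" and r :: real
    assume z: "z \<in> UNIV \<times> U"
    then have "z + r *\<^sub>R ((1, 0), 0) \<in> UNIV \<times> U" by (cases z) (auto simp: scaleR_prod_def)
    then show "G' (z + r *\<^sub>R ((1, 0), 0)) a b = G' z a b"
      using z by (simp add: G' scaleR_prod_def wave_form_def assms)
  qed
  then have "G' z0 (christoffel G' z0 a b) ((1, 0), 0) = 0"
    unfolding koszul by (simp add: const assms)
  then show ?thesis by (simp add: u[OF z0] christoffel_wave_u)
qed

end


section \<open>Submanifolds of a plane fronted wave\<close>

text \<open>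
  Applied to a coordinate function that parabolicity has forced to be constant, this turns the
  formula for its Laplacian into an equation for the mean curvature vector.
\<close>

lemma laplacian_constant:
  fixes S :: "('s, real ^ 'n) manifold"
  assumes S: "smooth_manifold S" "riemannian_metric S g" and p: "p \<in> topspace (mtop S)"
    and f: "\<And>q. q \<in> topspace (mtop S) \<Longrightarrow> f q = k"
  shows "laplacian S g f p = 0"
proof -
  define c where "c = chart_at S p"
  have c: "c \<in> atlas S" "p \<in> cdom c"
    unfolding c_def using S(1) p by (auto intro!: chart_at_works simp: smooth_manifold_def)
  note G = riemannian_metric_on[OF S c(1)]
  have x: "cmap c p \<in> cimg c" using c by blast
  have fc: "(f \<circ> cinv c) z = k" if "z \<in> cimg c" for z
    using f[OF smooth_manifold_cdom[OF S(1) c(1) cinv_in[OF that]]] by simp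
  have d0: "dderiv (f \<circ> cinv c) z w = 0" if "z \<in> cimg c" for z w
    by (subst dderiv_cong_open[OF differentiable_const metric_on_open[OF G] that fc[symmetric]])
      simp_all
  have "divergence (in_chart S g c) (gradient (in_chart S g c) (f \<circ> cinv c)) (cmap c p)
      = metric_trace (in_chart S g c (cmap c p))
          (hessian (in_chart S g c) (f \<circ> cinv c) (cmap c p))"
  proof (rule divergence_gradient[OF G x])
    show "(f \<circ> cinv c) differentiable (at z)" if "z \<in> cimg c" for z
      by (rule differentiable_cong_open[OF differentiable_const metric_on_open[OF G] that fc[symmetric]])
    show "(\<lambda>z. dderiv (f \<circ> cinv c) z w) differentiable (at (cmap c p))" for w
      by (rule differentiable_cong_open[OF differentiable_const metric_on_open[OF G] x d0[symmetric]])
  qed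
  also have "\<dots> = 0"
    by (simp add: metric_trace_def hessian_locally_constant[OF metric_on_open[OF G] x fc])
  finally show ?thesis by (simp add: laplacian_def Let_def c_def)
qed

text \<open>
  The mean curvature vector and the Laplacian are defined in the charts selected by \<open>chart_at\<close>.
  The set \<open>V\<close> is the coordinate image of a neighbourhood of \<open>p\<close> that \<open>\<psi>\<close> maps into the selected
  chart of the wave, so that all coordinate expressions are defined and regular on it.
\<close>

lemma submanifold_in_charts:
  fixes M :: "('m, 'e::euclidean_space) manifold" and S :: "('s, 'f::euclidean_space) manifold"
  assumes M: "smooth_manifold M" and S: "spacelike_submanifold S (pfw_manifold M) g \<psi>"
    and p: "p \<in> topspace (mtop S)"
  obtains d V where "d \<in> atlas M" "snd (\<psi> p) \<in> cdom d" "chart_at (pfw_manifold M) (\<psi> p) = wave_chart d"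
    "chart_at S p \<in> atlas S" "p \<in> cdom (chart_at S p)"
    "open V" "cmap (chart_at S p) p \<in> V" "V \<subseteq> cimg (chart_at S p)"
    "smooth_on V (cmap (wave_chart d) \<circ> \<psi> \<circ> cinv (chart_at S p))"
    "metric_on V (in_chart S (induced_metric (pfw_manifold M) g \<psi>) (chart_at S p))"
proof -
  let ?N = "pfw_manifold M" and ?c = "chart_at S p"
  have sm: "smooth_manifold S" "riemannian_metric S (induced_metric ?N g \<psi>)"
    and \<psi>: "smooth_map S ?N \<psi>"
    using S by (simp_all add: spacelike_submanifold_def immersion_def)
  have cont: "continuous_map (mtop S) (mtop ?N) \<psi>" using \<psi> by (simp add: smooth_map_def)
  have c: "?c \<in> atlas S" "p \<in> cdom ?c"
    using sm(1) p by (auto intro!: chart_at_works simp: smooth_manifold_def)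
  have "\<psi> p \<in> topspace (mtop ?N)"
    using cont p continuous_map_image_subset_topspace by blast
  then have "snd (\<psi> p) \<in> topspace (mtop M)" by (auto simp: topspace_pfw)
  then obtain d0 where "d0 \<in> atlas M" "snd (\<psi> p) \<in> cdom d0"
    using M unfolding smooth_manifold_def by blast
  then have "\<exists>e\<in>atlas ?N. \<psi> p \<in> cdom e"
    by (auto simp: atlas_pfw mem_Times_iff intro!: bexI[of _ d0])
  note e = chart_at_works[OF this]
  then obtain d where d: "d \<in> atlas M" and ed: "chart_at ?N (\<psi> p) = wave_chart d"
    unfolding atlas_pfw by blast
  have pd: "snd (\<psi> p) \<in> cdom d" using e(2) by (auto simp: ed)
  define V where "V = cmap ?c ` {q \<in> cdom ?c. \<psi> q \<in> cdom (wave_chart d)}"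
  have V: "open V"
    unfolding V_def
  proof (rule chart_open_image[OF smooth_manifold_chart[OF sm(1) c(1)]])
    have "openin (mtop ?N) (cdom (wave_chart d))"
      using smooth_manifold_chart[OF M d] by (intro openin_cdom_wave_chart) (simp add: is_chart_def)
    then have "openin (mtop S) {q \<in> topspace (mtop S). \<psi> q \<in> cdom (wave_chart d)}"
      by (rule openin_continuous_map_preimage[OF cont])
    moreover have "openin (mtop S) (cdom ?c)"
      using smooth_manifold_chart[OF sm(1) c(1)] by (simp add: is_chart_def)
    ultimately have "openin (mtop S) (cdom ?c \<inter> {q \<in> topspace (mtop S). \<psi> q \<in> cdom (wave_chart d)})"
      by (intro openin_Int)
    also have "cdom ?c \<inter> {q \<in> topspace (mtop S). \<psi> q \<in> cdom (wave_chart d)}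
        = {q \<in> cdom ?c. \<psi> q \<in> cdom (wave_chart d)}"
      using smooth_manifold_cdom[OF sm(1) c(1)] by blast
    finally show "openin (mtop S) {q \<in> cdom ?c. \<psi> q \<in> cdom (wave_chart d)}" .
  qed blast
  have V': "V \<subseteq> cimg ?c" by (auto simp: V_def)
  show thesis
  proof (rule that[OF d pd ed c V _ V'])
    show "cmap ?c p \<in> V" using c e(2) unfolding V_def ed by blast
    show "smooth_on V (cmap (wave_chart d) \<circ> \<psi> \<circ> cinv ?c)"
      using \<psi> c(1) d unfolding smooth_map_def atlas_pfw V_def by blast
    show "metric_on V (in_chart S (induced_metric ?N g \<psi>) ?c)"
      by (rule metric_on_subset[OF riemannian_metric_on[OF sm c(1)] V V'])
  qed
qed

lemma smooth_fun_wave_coordinate: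
  fixes M :: "('m, 'e::euclidean_space) manifold" and S :: "('s, 'f::euclidean_space) manifold"
  assumes M: "smooth_manifold M" and S: "spacelike_submanifold S (pfw_manifold M) g \<psi>"
    and L: "bounded_linear L"
  shows "smooth_fun S (\<lambda>q. L (fst (\<psi> q)))"
  unfolding smooth_fun_def
proof
  fix p assume "p \<in> topspace (mtop S)"
  from submanifold_in_charts[OF M S this] obtain d V where
    "d \<in> atlas M" "snd (\<psi> p) \<in> cdom d" "chart_at (pfw_manifold M) (\<psi> p) = wave_chart d"
    and c: "chart_at S p \<in> atlas S" "p \<in> cdom (chart_at S p)"
    and V: "open V" "cmap (chart_at S p) p \<in> V" "V \<subseteq> cimg (chart_at S p)"
    and F: "smooth_on V (cmap (wave_chart d) \<circ> \<psi> \<circ> cinv (chart_at S p))"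
    and "metric_on V (in_chart S (induced_metric (pfw_manifold M) g \<psi>) (chart_at S p))" .
  have "smooth_on V ((\<lambda>q. L (fst (\<psi> q))) \<circ> cinv (chart_at S p))"
    unfolding smooth_on_def
  proof
    fix k
    have "Ck_on k V (\<lambda>z. L (fst ((cmap (wave_chart d) \<circ> \<psi> \<circ> cinv (chart_at S p)) z)))"
      using Ck_on_linear_comp[OF bounded_linear_compose[OF L bounded_linear_fst] V(1)] F
      unfolding smooth_on_def by blast
    then show "Ck_on k V ((\<lambda>q. L (fst (\<psi> q))) \<circ> cinv (chart_at S p))"
      by (rule Ck_on_cong[OF _ V(1)]) simp
  qed
  then show "smooth_near S p (\<lambda>q. L (fst (\<psi> q)))"
    unfolding smooth_near_def using c V by blast
qed

text \<open>
  The equations \<open>\<Delta> \<mu> = n * du(H)\<close> and, if \<open>\<mu>\<close> is constant, \<open>\<Delta> \<nu> = n * dv(H)\<close>. The factor \<open>r\<close> makes the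
  equations available for \<open>- \<mu>\<close> and \<open>- \<nu>\<close>.
\<close>

lemma mean_curvature_laplacian:
  fixes M :: "('m, 'e::euclidean_space) manifold" and S :: "('s, real ^ 'n) manifold"
  assumes M: "smooth_manifold M" "riemannian_metric M g"
    and \<H>: "smooth_fun (pfw_manifold M) (\<lambda>((u, v), x). \<H> u x)"
    and S: "spacelike_submanifold S (pfw_manifold M) (pfw_metric M g \<H>) \<psi>"
    and p: "p \<in> topspace (mtop S)"
  obtains d H where "d \<in> atlas M" "snd (\<psi> p) \<in> cdom d"
    "mean_curvature_vector S (pfw_manifold M) (pfw_metric M g \<H>) \<psi> p
      = coord_vec (pfw_manifold M) (wave_chart d) (\<psi> p) H"
    "\<And>r. laplacian S (induced_metric (pfw_manifold M) (pfw_metric M g \<H>) \<psi>)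
        (\<lambda>q. r * coord_u (\<psi> q)) p = r * real CARD('n) * fst (fst H)"
    "\<And>r k. (\<And>q. q \<in> topspace (mtop S) \<Longrightarrow> coord_u (\<psi> q) = k) \<Longrightarrow>
      laplacian S (induced_metric (pfw_manifold M) (pfw_metric M g \<H>) \<psi>)
        (\<lambda>q. r * coord_v (\<psi> q)) p = r * real CARD('n) * snd (fst H)"
proof -
  let ?N = "pfw_manifold M" and ?g = "pfw_metric M g \<H>"
  have smS: "smooth_manifold S" using S by (simp add: spacelike_submanifold_def)
  from submanifold_in_charts[OF M(1) S p] obtain d V where
    d: "d \<in> atlas M" "snd (\<psi> p) \<in> cdom d" and ed: "chart_at ?N (\<psi> p) = wave_chart d"
    and c: "chart_at S p \<in> atlas S" "p \<in> cdom (chart_at S p)"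
    and V: "open V" "cmap (chart_at S p) p \<in> V" "V \<subseteq> cimg (chart_at S p)"
    and F: "smooth_on V (cmap (wave_chart d) \<circ> \<psi> \<circ> cinv (chart_at S p))"
    and G: "metric_on V (in_chart S (induced_metric ?N ?g \<psi>) (chart_at S p))" .
  define F where "F = cmap (wave_chart d) \<circ> \<psi> \<circ> cinv (chart_at S p)"
  define G where "G = in_chart S (induced_metric ?N ?g \<psi>) (chart_at S p)"
  define G' where "G' = in_chart ?N ?g (wave_chart d)"
  define x where "x = cmap (chart_at S p) p"
  define T where "T = metric_trace (G x) (second_fundamental_form G' G F x)"
  note F = F[folded F_def] and G = G[folded G_def] and V = V[folded x_def]
  have Fx: "F x = (fst (\<psi> p), cmap d (snd (\<psi> p)))"
    using cinv_cmap[OF smooth_manifold_inj[OF smS c(1)] c(2)]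
    by (simp add: F_def x_def map_prod_def case_prod_beta)
  have fstF: "fst (F z) = fst (\<psi> (cinv (chart_at S p) z))" for z
    by (simp add: F_def)
  have G': "G' z = wave_form (\<H> (fst (fst z)) (cinv d (snd z))) (in_chart M g d (snd z))"
    if "z \<in> UNIV \<times> cimg d" for z
    unfolding G'_def by (rule in_chart_pfw_metric[OF M(1) d(1) that])
  have Fx_in: "F x \<in> UNIV \<times> cimg d" using d by (simp add: Fx)
  have dH: "(\<lambda>z. \<H> (fst (fst z)) (cinv d (snd z))) differentiable (at (F x))"
  proof (rule differentiable_cong_open[OF _ _ Fx_in])
    have "\<psi> p = (fst (\<psi> p), snd (\<psi> p))" by simp
    moreover have "\<psi> p \<in> topspace (mtop ?N)"
      using smooth_manifold_cdom[OF M(1) d] by (simp add: topspace_pfw mem_Times_iff)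
    ultimately have "smooth_near ?N (fst (\<psi> p), snd (\<psi> p)) (\<lambda>((u, v), x). \<H> u x)"
      using \<H> unfolding smooth_fun_def by simp
    from wave_smooth_near_differentiable[OF M(1) d this]
    show "((\<lambda>((u, v), x). \<H> u x) \<circ> cinv (wave_chart d)) differentiable (at (F x))"
      unfolding Fx .
    show "open (UNIV \<times> cimg d :: ((real \<times> real) \<times> 'e) set)"
      by (rule open_Times[OF open_UNIV smooth_manifold_open_cimg[OF M(1) d(1)]])
    show "((\<lambda>((u, v), x). \<H> u x) \<circ> cinv (wave_chart d)) z = \<H> (fst (fst z)) (cinv d (snd z))"
      if "z \<in> UNIV \<times> cimg d" for z
      using that cinv_wave_chart[OF smooth_manifold_inj[OF M(1) d(1)], of "snd z" "fst z"]
      by (auto simp: case_prod_beta)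
  qed
  note chr_u = christoffel_wave_u[where h = "\<lambda>u y. \<H> u (cinv d y)", OF G'
      riemannian_metric_on[OF M d(1)] Fx_in dH]
  note chr_v = christoffel_wave_v[where h = "\<lambda>u y. \<H> u (cinv d y)", OF G'
      riemannian_metric_on[OF M d(1)] Fx_in dH]
  note dF = smooth_on_differentiable[OF F] and dF2 = smooth_on_dderiv_differentiable[OF F V(2)]
  \<comment> \<open>Product charts leave \<open>(u, v)\<close> unchanged, so \<open>L\<close> composed with \<open>fst \<circ> \<psi>\<close> is \<open>L \<circ> fst\<close> of the
    coordinate expression \<open>F\<close>, and the Gauss formula applies to the linear map \<open>L \<circ> fst\<close>.\<close>
  have lap: "laplacian S (induced_metric ?N ?g \<psi>) (\<lambda>q. L (fst (\<psi> q))) p = L (fst T)"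
    if L: "bounded_linear L"
      and geo: "\<And>a b. L (fst (christoffel G' (F x) (dderiv F x a) (dderiv F x b))) = 0"
    for L :: "real \<times> real \<Rightarrow> real"
  proof -
    note \<Lambda> = bounded_linear_compose[OF L bounded_linear_fst]
    have f: "(\<lambda>q. L (fst (\<psi> q))) \<circ> cinv (chart_at S p) = (\<lambda>z. L (fst (F z)))"
      by (simp add: fun_eq_iff fstF)
    have dd: "dderiv (\<lambda>z. L (fst (F z))) z w = L (fst (dderiv F z w))" if "z \<in> V" for z w
      by (rule dderiv_linear_comp[OF \<Lambda> dF[OF that]])
    have "laplacian S (induced_metric ?N ?g \<psi>) (\<lambda>q. L (fst (\<psi> q))) p
        = divergence G (gradient G (\<lambda>z. L (fst (F z)))) x"
      unfolding laplacian_def Let_def f G_def x_def ..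
    also have "\<dots> = metric_trace (G x) (hessian G (\<lambda>z. L (fst (F z))) x)"
    proof (rule divergence_gradient[OF G V(2)])
      show "(\<lambda>z. L (fst (F z))) differentiable (at z)" if "z \<in> V" for z
        by (rule differentiable_linear_comp[OF \<Lambda> dF[OF that]])
      show "(\<lambda>z. dderiv (\<lambda>z. L (fst (F z))) z w) differentiable (at x)" for w
        by (rule differentiable_cong_open[OF differentiable_linear_comp[OF \<Lambda> dF2] V(1,2)])
          (simp add: dd)
    qed
    also have "hessian G (\<lambda>z. L (fst (F z))) x
        = (\<lambda>a b. L (fst (second_fundamental_form G' G F x a b)))"
      by (intro ext second_fundamental_form_linear[OF \<Lambda> V(1,2) dF dF2 geo, symmetric])
    also have "metric_trace (G x) \<dots> = L (fst T)"
      unfolding T_def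
      by (rule metric_trace_linear[OF bounded_linear.linear[OF \<Lambda>], symmetric])
    finally show ?thesis .
  qed
  define H where "H = (1 / real CARD('n)) *\<^sub>R T"
  have T: "fst (fst T) = real CARD('n) * fst (fst H)" "snd (fst T) = real CARD('n) * snd (fst H)"
    by (simp_all add: H_def)
  show thesis
  proof (rule that[OF d, of H])
    show "mean_curvature_vector S ?N ?g \<psi> p = coord_vec ?N (wave_chart d) (\<psi> p) H"
      unfolding mean_curvature_vector_def Let_def ed H_def T_def G_def G'_def F_def x_def by simp
    show "laplacian S (induced_metric ?N ?g \<psi>) (\<lambda>q. r * coord_u (\<psi> q)) p
        = r * real CARD('n) * fst (fst H)" for r
    proof -
      have "bounded_linear (\<lambda>w::real \<times> real. r * fst w)"
        by (rule bounded_linear_compose[OF bounded_linear_mult_right bounded_linear_fst])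
      from lap[OF this] show ?thesis
        by (simp add: chr_u T coord_u_def case_prod_beta)
    qed
    show "laplacian S (induced_metric ?N ?g \<psi>) (\<lambda>q. r * coord_v (\<psi> q)) p
        = r * real CARD('n) * snd (fst H)"
      if const: "\<And>q. q \<in> topspace (mtop S) \<Longrightarrow> coord_u (\<psi> q) = k" for r k
    proof -
      have bl: "bounded_linear (\<lambda>w::real \<times> real. r * snd w)"
        by (rule bounded_linear_compose[OF bounded_linear_mult_right bounded_linear_snd])
      \<comment> \<open>Here the constancy of \<open>u\<close> along the submanifold brings in \<open>christoffel_wave_v\<close>.\<close>
      have tangent: "fst (fst (dderiv F x a)) = 0" for a
      proof -
        have uF: "fst (fst (F z)) = k" if "z \<in> V" for z
          using const[OF smooth_manifold_cdom[OF smS c(1) cinv_in], of z] that V(3)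
          by (auto simp: fstF coord_u_def case_prod_beta)
        have "fst (fst (dderiv F x a)) = dderiv (\<lambda>z. fst (fst (F z))) x a"
          by (rule dderiv_linear_comp[OF bounded_linear_compose[OF bounded_linear_fst bounded_linear_fst]
                dF[OF V(2)], symmetric])
        also have "\<dots> = 0"
          by (subst dderiv_cong_open[OF differentiable_const V(1,2) uF[symmetric]]) simp_all
        finally show ?thesis .
      qed
      from lap[OF bl] show ?thesis
        by (simp add: chr_v tangent T coord_v_def case_prod_beta)
    qed
  qed
qed


section \<open>Trapped submanifolds\<close>

text \<open>
  The numbers \<open>hu\<close> and \<open>hv\<close> are the \<open>u\<close>- and \<open>v\<close>-components of the mean curvature vector. If
  \<open>hu = 0\<close>, then this vector is \<open>hv\<close> times \<open>\<partial>\<^sub>v\<close>, so that its time orientation is the sign of \<open>hv\<close>.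
  The value \<open>\<epsilon> = 1\<close> stands for future and \<open>\<epsilon> = - 1\<close> for past pointing.
\<close>

lemma trapped_mean_curvature:
  fixes M :: "('m, 'e::euclidean_space) manifold" and S :: "('s, real ^ 'n) manifold"
  assumes pfw: "plane_fronted_wave M g \<H> \<tau>" and \<epsilon>: "\<epsilon> \<in> {1, -1}"
    and S: "spacelike_submanifold S (pfw_manifold M) (pfw_metric M g \<H>) \<psi>"
    and p: "p \<in> topspace (mtop S)"
    and causal: "causal (pfw_metric M g \<H>) (\<psi> p)
      (mean_curvature_vector S (pfw_manifold M) (pfw_metric M g \<H>) \<psi> p)"
    and pointing: "\<epsilon> * pfw_metric M g \<H> (\<psi> p) (\<tau> (\<psi> p))
      (mean_curvature_vector S (pfw_manifold M) (pfw_metric M g \<H>) \<psi> p) < 0"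
  obtains hu hv where "\<epsilon> * hu \<le> 0" "hu = 0 \<longrightarrow> \<epsilon> * hv > 0"
    "\<forall>r. laplacian S (induced_metric (pfw_manifold M) (pfw_metric M g \<H>) \<psi>)
        (\<lambda>q. r * coord_u (\<psi> q)) p = r * real CARD('n) * hu"
    "\<forall>r k. (\<forall>q\<in>topspace (mtop S). coord_u (\<psi> q) = k) \<longrightarrow>
      laplacian S (induced_metric (pfw_manifold M) (pfw_metric M g \<H>) \<psi>)
        (\<lambda>q. r * coord_v (\<psi> q)) p = r * real CARD('n) * hv"
proof -
  let ?N = "pfw_manifold M" and ?g = "pfw_metric M g \<H>"
  have M: "smooth_manifold M" "riemannian_metric M g"
    and \<H>: "smooth_fun ?N (\<lambda>((u, v), x). \<H> u x)"
    and \<tau>: "smooth_vector_field ?N \<tau>"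
    and timelike: "\<And>q. q \<in> topspace (mtop ?N) \<Longrightarrow> timelike ?g q (\<tau> q)"
    and future: "\<And>q. q \<in> topspace (mtop ?N) \<Longrightarrow> ?g q (\<tau> q) (partial_v M q) < 0"
    using pfw unfolding plane_fronted_wave_def time_orientation_def future_pointing_def by blast+
  obtain d H where d: "d \<in> atlas M" "snd (\<psi> p) \<in> cdom d"
    and H: "mean_curvature_vector S ?N ?g \<psi> p = coord_vec ?N (wave_chart d) (\<psi> p) H"
    and lap: "\<And>r. laplacian S (induced_metric ?N ?g \<psi>) (\<lambda>q. r * coord_u (\<psi> q)) p
        = r * real CARD('n) * fst (fst H)"
      "\<And>r k. (\<And>q. q \<in> topspace (mtop S) \<Longrightarrow> coord_u (\<psi> q) = k) \<Longrightarrow>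
        laplacian S (induced_metric ?N ?g \<psi>) (\<lambda>q. r * coord_v (\<psi> q)) p
        = r * real CARD('n) * snd (fst H)"
    using mean_curvature_laplacian[OF M \<H> S p] by metis
  obtain w x where wx: "\<psi> p = (w, x)" by fastforce
  have x: "x \<in> cdom d" using d(2) by (simp add: wx)
  have q: "(w, x) \<in> topspace (mtop ?N)"
    using smooth_manifold_cdom[OF M(1) d(1) x] by (simp add: topspace_pfw)
  define \<gamma> where "\<gamma> = in_chart M g d (cmap d x)"
  define W where "W = wave_form (\<H> (fst w) x) \<gamma>"
  have gW: "?g (w, x) (coord_vec ?N (wave_chart d) (w, x) a) (coord_vec ?N (wave_chart d) (w, x) b)
      = W a b" for a b
    unfolding W_def \<gamma>_def by (rule pfw_metric_coord_vec[OF M(1) d(1) x])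
  have \<gamma>: "bilinear \<gamma>" "\<And>y z. \<gamma> y z = \<gamma> z y" "\<And>y. y \<noteq> 0 \<Longrightarrow> \<gamma> y y > 0"
    using metric_onD(1,2,3)[OF riemannian_metric_on[OF M d(1)] imageI[OF x]]
    unfolding \<gamma>_def by blast+
  obtain t where t: "\<tau> (w, x) = coord_vec ?N (wave_chart d) (w, x) t"
    using \<tau> d(1) x unfolding smooth_vector_field_def atlas_pfw by fastforce
  have tt: "W t t < 0"
    using timelike[OF q] by (simp add: timelike_def t gW)
  have tu: "fst (fst t) < 0"
    using future[OF q] by (simp add: partial_v_eq_coord_vec[OF M(1) d(1) x] t gW)
      (simp add: W_def wave_form_partial_v[OF \<gamma>(1)])
  have HH: "W H H \<le> 0"
    using causal by (auto simp: causal_def timelike_def lightlike_def H wx gW)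
  have tH: "\<epsilon> * W t H < 0"
    using pointing by (simp add: H wx t gW)
  note bil = bilinear_wave_form[OF \<gamma>(1), of "\<H> (fst w) x", folded W_def]
  have "fst (fst (\<epsilon> *\<^sub>R H)) \<le> 0"
  proof (rule wave_form_timecone[OF \<gamma> tt[unfolded W_def] tu])
    show "wave_form (\<H> (fst w) x) \<gamma> (\<epsilon> *\<^sub>R H) (\<epsilon> *\<^sub>R H) \<le> 0"
      using HH \<epsilon> by (auto simp: bilinear_lmul[OF bil] bilinear_rmul[OF bil] W_def[symmetric])
    show "wave_form (\<H> (fst w) x) \<gamma> t (\<epsilon> *\<^sub>R H) < 0"
      using tH by (simp add: bilinear_rmul[OF bil] W_def[symmetric])
  qed
  then have "\<epsilon> * fst (fst H) \<le> 0" by simp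
  moreover have "\<epsilon> * snd (fst H) > 0" if "fst (fst H) = 0"
  proof -
    have "snd H = 0"
      by (rule wave_form_causal_null[OF \<gamma>(3) that HH[unfolded W_def]])
    then have "W t H = fst (fst t) * snd (fst H)"
      using that by (simp add: W_def wave_form_def bilinear_rzero[OF \<gamma>(1)])
    then have "fst (fst t) * (\<epsilon> * snd (fst H)) < 0"
      using tH by (simp add: mult.left_commute)
    then show ?thesis using tu by (simp add: mult_less_0_iff)
  qed
  ultimately show thesis
    by (intro that[of "fst (fst H)" "snd (fst H)"] allI impI lap) auto
qed

text \<open>
  Parabolicity is used twice: for \<open>\<epsilon> * \<mu>\<close>, to make \<open>\<mu>\<close> constant, and then for \<open>- \<epsilon> * \<nu>\<close>, whose Laplacian
  would be negative everywhere and zero at the same time.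
\<close>

lemma no_parabolic_weakly_trapped:
  fixes M :: "('m, 'e::euclidean_space) manifold" and S :: "('s, real ^ 'n) manifold"
  assumes pfw: "plane_fronted_wave M g \<H> \<tau>" and \<epsilon>: "\<epsilon> \<in> {1, -1}"
    and S: "spacelike_submanifold S (pfw_manifold M) (pfw_metric M g \<H>) \<psi>"
    and causal: "\<And>p. p \<in> topspace (mtop S) \<Longrightarrow> causal (pfw_metric M g \<H>) (\<psi> p)
      (mean_curvature_vector S (pfw_manifold M) (pfw_metric M g \<H>) \<psi> p)"
    and pointing: "\<And>p. p \<in> topspace (mtop S) \<Longrightarrow> \<epsilon> * pfw_metric M g \<H> (\<psi> p) (\<tau> (\<psi> p))
      (mean_curvature_vector S (pfw_manifold M) (pfw_metric M g \<H>) \<psi> p) < 0"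
    and par: "parabolic S (induced_metric (pfw_manifold M) (pfw_metric M g \<H>) \<psi>)"
    and bdd: "bdd_below ((\<lambda>q. \<epsilon> * coord_u (\<psi> q)) ` topspace (mtop S))"
      "bdd_below ((\<lambda>q. - \<epsilon> * coord_v (\<psi> q)) ` topspace (mtop S))"
  shows False
proof -
  let ?G = "induced_metric (pfw_manifold M) (pfw_metric M g \<H>) \<psi>"
  let ?S = "topspace (mtop S)"
  have M: "smooth_manifold M" using pfw by (simp add: plane_fronted_wave_def)
  have smS: "smooth_manifold S" "riemannian_metric S ?G"
    using S by (simp_all add: spacelike_submanifold_def)
  obtain p where p: "p \<in> ?S" using smS(1) unfolding smooth_manifold_def by blast
  have liouville: "\<exists>k. \<forall>q\<in>?S. f q = k"
    if "smooth_fun S f" "\<And>q. q \<in> ?S \<Longrightarrow> laplacian S ?G f q \<le> 0" "bdd_below (f ` ?S)" for f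
    using par that unfolding parabolic_def superharmonic_def constant_on_def by blast
  note point = trapped_mean_curvature[OF pfw \<epsilon> S _ causal pointing]
  have smooth: "smooth_fun S (\<lambda>q. r * coord_u (\<psi> q))" "smooth_fun S (\<lambda>q. r * coord_v (\<psi> q))" for r
    using smooth_fun_wave_coordinate[OF M S
        bounded_linear_compose[OF bounded_linear_mult_right[of r] bounded_linear_fst]]
      smooth_fun_wave_coordinate[OF M S
        bounded_linear_compose[OF bounded_linear_mult_right[of r] bounded_linear_snd]]
    by (simp_all add: coord_u_def coord_v_def case_prod_beta)
  have "\<exists>k. \<forall>q\<in>?S. \<epsilon> * coord_u (\<psi> q) = k"
  proof (rule liouville[OF smooth(1) _ bdd(1)])
    fix q assume q: "q \<in> ?S"
    from point[OF q q q] obtain hu hv where hu: "\<epsilon> * hu \<le> 0"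
      and "hu = 0 \<longrightarrow> \<epsilon> * hv > 0"
      and lap: "\<forall>r. laplacian S ?G (\<lambda>q. r * coord_u (\<psi> q)) q = r * real CARD('n) * hu"
      and "\<forall>r k. (\<forall>q\<in>?S. coord_u (\<psi> q) = k) \<longrightarrow>
        laplacian S ?G (\<lambda>q. r * coord_v (\<psi> q)) q = r * real CARD('n) * hv" .
    have "real CARD('n) * (\<epsilon> * hu) \<le> 0" using hu by (simp add: mult_nonneg_nonpos)
    then show "laplacian S ?G (\<lambda>q. \<epsilon> * coord_u (\<psi> q)) q \<le> 0"
      unfolding lap[rule_format] by (simp add: mult_ac)
  qed
  then obtain k0 where k0: "\<And>q. q \<in> ?S \<Longrightarrow> \<epsilon> * coord_u (\<psi> q) = k0" by blast
  have k: "coord_u (\<psi> q) = \<epsilon> * k0" if "q \<in> ?S" for q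
    using k0[OF that] \<epsilon> by auto
  have hv: "\<exists>hv. \<epsilon> * hv > 0 \<and>
      (\<forall>r. laplacian S ?G (\<lambda>q. r * coord_v (\<psi> q)) q = r * real CARD('n) * hv)"
    if q: "q \<in> ?S" for q
  proof -
    from point[OF q q q] obtain hu hv where "\<epsilon> * hu \<le> 0"
      and hu: "hu = 0 \<longrightarrow> \<epsilon> * hv > 0"
      "\<forall>r. laplacian S ?G (\<lambda>q. r * coord_u (\<psi> q)) q = r * real CARD('n) * hu"
      and hv: "\<forall>r k. (\<forall>q\<in>?S. coord_u (\<psi> q) = k) \<longrightarrow>
        laplacian S ?G (\<lambda>q. r * coord_v (\<psi> q)) q = r * real CARD('n) * hv" .
    have "laplacian S ?G (\<lambda>q. 1 * coord_u (\<psi> q)) q = 0"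
      by (rule laplacian_constant[OF smS q]) (simp add: k)
    then have "hu = 0" using hu(2)[rule_format, of 1] by simp
    then have "\<epsilon> * hv > 0" using hu(1) by simp
    moreover have "laplacian S ?G (\<lambda>q. r * coord_v (\<psi> q)) q = r * real CARD('n) * hv" for r
      using hv[rule_format, of "\<epsilon> * k0" r] k by simp
    ultimately show ?thesis by blast
  qed
  have "\<exists>k. \<forall>q\<in>?S. - \<epsilon> * coord_v (\<psi> q) = k"
  proof (rule liouville[OF smooth(2) _ bdd(2)])
    fix q assume "q \<in> ?S"
    from hv[OF this] obtain hv where hv: "\<epsilon> * hv > 0"
      "\<And>r. laplacian S ?G (\<lambda>q. r * coord_v (\<psi> q)) q = r * real CARD('n) * hv"
      by blast
    have "real CARD('n) * (\<epsilon> * hv) \<ge> 0" using hv(1) by simp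
    then show "laplacian S ?G (\<lambda>q. - \<epsilon> * coord_v (\<psi> q)) q \<le> 0"
      unfolding hv(2) by (simp add: mult_ac)
  qed
  then obtain k1 where "\<And>q. q \<in> ?S \<Longrightarrow> - \<epsilon> * coord_v (\<psi> q) = k1" by blast
  then have "laplacian S ?G (\<lambda>q. - \<epsilon> * coord_v (\<psi> q)) p = 0"
    by (rule laplacian_constant[OF smS p])
  moreover from hv[OF p] obtain hv where "\<epsilon> * hv > 0"
    "\<And>r. laplacian S ?G (\<lambda>q. r * coord_v (\<psi> q)) p = r * real CARD('n) * hv"
    by blast
  ultimately show False by (simp only: mult_eq_0_iff) auto
qed

theorem theorem14:
  fixes M :: "('m, real ^ 'n) manifold"
    and g :: "'m metric_tensor"
    and \<H> :: "real \<Rightarrow> 'm \<Rightarrow> real"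
    and \<tau> :: "(real \<times> real) \<times> 'm \<Rightarrow> ((real \<times> real) \<times> 'm) tvec"
  assumes "plane_fronted_wave M g \<H> \<tau>"
  shows
    "(\<nexists>(\<Sigma> :: ('s, real ^ 'n) manifold) \<psi>.
        weakly_future_trapped \<Sigma> (pfw_manifold M) (pfw_metric M g \<H>) \<tau> \<psi> \<and>
        parabolic \<Sigma> (induced_metric (pfw_manifold M) (pfw_metric M g \<H>) \<psi>) \<and>
        bdd_below ((coord_u \<circ> \<psi>) ` topspace (mtop \<Sigma>)) \<and>
        bdd_above ((coord_v \<circ> \<psi>) ` topspace (mtop \<Sigma>))) \<and>
     (\<nexists>(\<Sigma> :: ('s, real ^ 'n) manifold) \<psi>.
        weakly_past_trapped \<Sigma> (pfw_manifold M) (pfw_metric M g \<H>) \<tau> \<psi> \<and>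
        parabolic \<Sigma> (induced_metric (pfw_manifold M) (pfw_metric M g \<H>) \<psi>) \<and>
        bdd_above ((coord_u \<circ> \<psi>) ` topspace (mtop \<Sigma>)) \<and>
        bdd_below ((coord_v \<circ> \<psi>) ` topspace (mtop \<Sigma>)))"
proof -
  let ?N = "pfw_manifold M" and ?g = "pfw_metric M g \<H>"
  have neg: "bdd_below ((\<lambda>q. - f q) ` A)" if "bdd_above (f ` A)" for f :: "'s \<Rightarrow> real" and A
    using that unfolding bdd_above_def bdd_below_def by (auto simp: image_iff) (metis neg_le_iff_le)
  have future: False
    if "weakly_future_trapped \<Sigma> ?N ?g \<tau> \<psi>" "parabolic \<Sigma> (induced_metric ?N ?g \<psi>)"
      "bdd_below ((coord_u \<circ> \<psi>) ` topspace (mtop \<Sigma>))"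
      "bdd_above ((coord_v \<circ> \<psi>) ` topspace (mtop \<Sigma>))"
    for \<Sigma> :: "('s, real ^ 'n) manifold" and \<psi>
    using that neg[OF that(4)]
    by (intro no_parabolic_weakly_trapped[OF assms, of 1 \<Sigma> \<psi>])
      (simp_all add: weakly_future_trapped_def future_pointing_def comp_def)
  have past: False
    if "weakly_past_trapped \<Sigma> ?N ?g \<tau> \<psi>" "parabolic \<Sigma> (induced_metric ?N ?g \<psi>)"
      "bdd_above ((coord_u \<circ> \<psi>) ` topspace (mtop \<Sigma>))"
      "bdd_below ((coord_v \<circ> \<psi>) ` topspace (mtop \<Sigma>))"
    for \<Sigma> :: "('s, real ^ 'n) manifold" and \<psi>
    using that neg[OF that(3)]
    by (intro no_parabolic_weakly_trapped[OF assms, of "-1" \<Sigma> \<psi>])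
      (simp_all add: weakly_past_trapped_def past_pointing_def comp_def)
  show ?thesis
    by (intro conjI notI; elim exE conjE) (rule future past; assumption)+
qed

end
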